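(* There exists a universal constant $c_2$ with $$ \frac{9}{8} < c_2 \leq 8$$ such that if $\Omega \subset \mathbb{R}^2$ is a convex domain and $f:\Omega \to \mathbb{R}$ is a convex function that is positive on the boundary in the sense that $f|_{\partial\Omega} \geq 0$, then $$ \frac{1}{|\Omega|} \int_{\Omega} f \, d\mathcal{H}^2 \leq \frac{c_2}{|\partial \Omega|} \int_{\partial \Omega} f \, d\mathcal{H}^{1}.$$
   Context: $\mathcal{H}^k$ is the $k$-dimensional Hausdorff measure; $|\Omega| = \mathcal{H}^2(\Omega)$ is the area of $\Omega$ and $|\partial\Omega| = \mathcal{H}^{1}(\partial\Omega)$ is the length of its boundary. $f|_{\partial\Omega}$ denotes the boundary values of $f$ on $\partial\Omega$. "Universal" means that $c_2$ depends on neither $\Omega$ nor $f$. *)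

theory Defs
  imports "HOL-Analysis.Analysis"
begin

text \<open>The $k$-dimensional Hausdorff measure, with the usual normalisation
  $\omega_k (\mathrm{diam}\, C / 2)^k$ for the cost of a covering set. The function
  \<^const>\<open>diameter\<close> is only meaningful on bounded sets. Empty covering sets cost nothing also for
  $k = 0$, so that sequences encode finite coverings.\<close>

definition hausdorff_content :: "nat \<Rightarrow> real \<Rightarrow> 'a::metric_space set \<Rightarrow> ennreal" where
  "hausdorff_content k \<delta> A =
     (INF C \<in> {C :: nat \<Rightarrow> 'a set. A \<subseteq> (\<Union>i. C i) \<and> (\<forall>i. bounded (C i) \<and> diameter (C i) \<le> \<delta>)}.
        \<Sum>i. if C i = {} then 0
            else ennreal (unit_ball_vol (real k) * (diameter (C i) / 2) ^ k))"

definition hausdorff_outer :: "nat \<Rightarrow> 'a::metric_space set \<Rightarrow> ennreal" where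
  "hausdorff_outer k A = (SUP \<delta> \<in> {0<..}. hausdorff_content k \<delta> A)"

text \<open>As a metric outer measure, \<^const>\<open>hausdorff_outer\<close> is countably additive on Borel sets, so
  \<^const>\<open>measure_of\<close> does not fall back to the null measure here.\<close>

definition hausdorff_measure :: "nat \<Rightarrow> 'a::metric_space measure" where
  "hausdorff_measure k = measure_of UNIV (sets borel) (hausdorff_outer k)"

text \<open>A convex domain of finite area is bounded. The function is taken to be defined and convex on
  the closure, so that its boundary values are its restriction to the frontier; no continuity at the
  boundary is required. Integrability over the boundary excludes only the cases where the
  right-hand side is infinite (the inequality being void) or undefined because the boundary values
  are not measurable; a Bochner integral would silently be 0 there. For the same reason
  integrability over the domain is part of the conclusion.\<close>

definition hermite_hadamard_constant :: "real \<Rightarrow> bool" where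
  "hermite_hadamard_constant c \<longleftrightarrow>
     (\<forall>(\<Omega> :: (real ^ 2) set) (f :: real ^ 2 \<Rightarrow> real).
        open \<Omega> \<and> \<Omega> \<noteq> {} \<and> bounded \<Omega> \<and> convex \<Omega> \<and>
        convex_on (closure \<Omega>) f \<and>
        (\<forall>x\<in>frontier \<Omega>. 0 \<le> f x) \<and>
        set_integrable (hausdorff_measure 1) (frontier \<Omega>) f
        \<longrightarrow>
        set_integrable (hausdorff_measure 2) \<Omega> f \<and>
        1 / measure (hausdorff_measure 2) \<Omega> * (LINT x:\<Omega>|hausdorff_measure 2. f x)
          \<le> c / measure (hausdorff_measure 1) (frontier \<Omega>)
              * (LINT x:frontier \<Omega>|hausdorff_measure 1. f x))"

end

theory Submission
  imports Defs
begin

text \<open>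
  Why the constant \<open>8\<close> works. Cut the domain by lines in one coordinate direction. On such a
  chord a convex function lies below the affine function with the same end values, so its integral
  over the chord is at most half the chord length times the sum of the two end values. Fubini
  turns this into a bound of \<open>\<integral>\<^sub>\<Omega> f\<close> by the longest chord and by the integral over the shadow of
  \<open>\<Omega>\<close> of the end values of \<open>f\<close>. The latter is at most the boundary integral of \<open>f\<close>, because orthogonal
  projection does not increase \<open>\<H>\<^sup>1\<close> (\<open>ends_integral_le\<close>). With \<open>w\<close> the width of the shadow, the
  longest chord is at most \<open>4 |\<Omega>| / w\<close>: halfway between a long chord and any point of the domain
  there is still a chord of half the length (\<open>slice_length_le\<close>). Finally the perimeter is at most
  that of the bounding box, because the nearest-point projection maps the boundary of the box onto
  the boundary of \<open>\<Omega>\<close> (\<open>perimeter_le\<close>); choosing the coordinate with the larger width gives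
  \<open>|\<partial>\<Omega>| \<le> 4 w\<close>, and \<open>2 / w \<le> 8 / |\<partial>\<Omega>|\<close>.

  Why no constant up to \<open>9/8\<close> works. In a thin triangle with apex at the origin the first coordinate
  has mean \<open>2/3\<close> over the area, whereas its mean over the boundary is close to \<open>1/2\<close>, since it is
  exactly \<open>1/2\<close> on each of the two long sides, by symmetry (\<open>hermite_hadamard_constant_ge\<close>).

  The set of admissible constants is closed, so its infimum is the optimal constant.

  Normalised means over the area do not see a constant factor in the planar measure. Hence it is
  enough that \<open>\<H>\<^sup>2\<close> is some positive multiple of Lebesgue measure (\<open>hausdorff_measure_2_eq\<close>), which
  follows from invariance alone, without the isodiametric inequality.
\<close>

section \<open>Hausdorff measures are Borel measures\<close>

definition covering_cost :: "nat \<Rightarrow> 'a::metric_space set \<Rightarrow> ennreal" where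
  "covering_cost k C =
     (if C = {} then 0 else ennreal (unit_ball_vol (real k) * (diameter C / 2) ^ k))"

definition fine_cover :: "real \<Rightarrow> 'a::metric_space set \<Rightarrow> (nat \<Rightarrow> 'a set) \<Rightarrow> bool" where
  "fine_cover \<delta> A C \<longleftrightarrow> A \<subseteq> (\<Union>i. C i) \<and> (\<forall>i. bounded (C i) \<and> diameter (C i) \<le> \<delta>)"

lemma hausdorff_content_eq:
  "hausdorff_content k \<delta> A = (INF C \<in> Collect (fine_cover \<delta> A). \<Sum>i. covering_cost k (C i))"
  unfolding hausdorff_content_def fine_cover_def covering_cost_def by simp

lemma covering_cost_empty [simp]: "covering_cost k {} = 0"
  by (simp add: covering_cost_def)

lemma hausdorff_content_le:
  "fine_cover \<delta> A C \<Longrightarrow> hausdorff_content k \<delta> A \<le> (\<Sum>i. covering_cost k (C i))"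
  unfolding hausdorff_content_eq by (rule INF_lower) simp

lemma le_hausdorff_content:
  "(\<And>C. fine_cover \<delta> A C \<Longrightarrow> x \<le> (\<Sum>i. covering_cost k (C i))) \<Longrightarrow> x \<le> hausdorff_content k \<delta> A"
  unfolding hausdorff_content_eq by (rule INF_greatest) simp

lemma hausdorff_content_mono:
  "A \<subseteq> B \<Longrightarrow> \<delta> \<le> \<epsilon> \<Longrightarrow> hausdorff_content k \<epsilon> A \<le> hausdorff_content k \<delta> B"
  by (rule le_hausdorff_content, rule hausdorff_content_le)
     (meson fine_cover_def order_trans)

lemma hausdorff_content_le_outer:
  "0 < \<delta> \<Longrightarrow> hausdorff_content k \<delta> A \<le> hausdorff_outer k A"
  unfolding hausdorff_outer_def by (rule SUP_upper) simp

lemma hausdorff_outer_le: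
  "(\<And>\<delta>. 0 < \<delta> \<Longrightarrow> hausdorff_content k \<delta> A \<le> x) \<Longrightarrow> hausdorff_outer k A \<le> x"
  unfolding hausdorff_outer_def by (rule SUP_least) simp

lemma hausdorff_outer_mono: "A \<subseteq> B \<Longrightarrow> hausdorff_outer k A \<le> hausdorff_outer k B"
  by (intro hausdorff_outer_le order_trans[OF hausdorff_content_mono[of A B] hausdorff_content_le_outer])
     auto

lemma hausdorff_outer_empty [simp]: "hausdorff_outer k {} = 0"
proof -
  have "hausdorff_outer k ({}::'a set) \<le> 0"
  proof (rule hausdorff_outer_le)
    fix \<delta> :: real assume "0 < \<delta>"
    then have "hausdorff_content k \<delta> ({}::'a set) \<le> (\<Sum>i. covering_cost k ((\<lambda>_. {}::'a set) i))"
      by (intro hausdorff_content_le) (auto simp: fine_cover_def)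
    then show "hausdorff_content k \<delta> ({}::'a set) \<le> 0" by simp
  qed
  then show ?thesis by simp
qed

lemma hausdorff_content_UN_le:
  "hausdorff_content k \<delta> (\<Union>n::nat. A n) \<le> (\<Sum>n. hausdorff_content k \<delta> (A n))"
proof (cases "\<exists>n. hausdorff_content k \<delta> (A n) = top")
  case True
  then have "(\<Sum>n. hausdorff_content k \<delta> (A n)) = top"
    by (metis ennreal_suminf_lessD less_irrefl less_top)
  then show ?thesis by simp
next
  case False
  show ?thesis
  proof (rule ennreal_le_epsilon)
    fix e :: real assume e: "0 < e"
    have "\<exists>C. fine_cover \<delta> (A n) C \<and>
        (\<Sum>i. covering_cost k (C i)) < hausdorff_content k \<delta> (A n) + ennreal (e * (1/2) ^ Suc n)" for n
    proof -
      have "0 < ennreal (e * (1/2) ^ Suc n)" using e by simp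
      moreover have "hausdorff_content k \<delta> (A n) < top" using False by (simp add: less_top)
      ultimately have "hausdorff_content k \<delta> (A n)
          < hausdorff_content k \<delta> (A n) + ennreal (e * (1/2) ^ Suc n)"
        by (metis add.right_neutral ennreal_add_left_cancel_less infinity_ennreal_def less_top)
      then show ?thesis
        by (auto simp: hausdorff_content_eq INF_less_iff)
    qed
    then obtain C where C: "\<And>n. fine_cover \<delta> (A n) (C n)"
      and less: "\<And>n. (\<Sum>i. covering_cost k (C n i))
          < hausdorff_content k \<delta> (A n) + ennreal (e * (1/2) ^ Suc n)"
      by metis
    let ?D = "\<lambda>m. C (fst (prod_decode m)) (snd (prod_decode m))"
    have "fine_cover \<delta> (\<Union>n. A n) ?D"
    proof -
      have "x \<in> (\<Union>m. ?D m)" if x: "x \<in> A n" for x n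
      proof -
        obtain i where "x \<in> C n i" using C[of n] x by (auto simp: fine_cover_def)
        then have "x \<in> ?D (prod_encode (n, i))" by simp
        then show ?thesis by blast
      qed
      moreover have "bounded (C n i) \<and> diameter (C n i) \<le> \<delta>" for n i
        using C[of n] by (simp add: fine_cover_def)
      ultimately show ?thesis unfolding fine_cover_def by blast
    qed
    then have "hausdorff_content k \<delta> (\<Union>n. A n) \<le> (\<Sum>m. covering_cost k (?D m))"
      by (rule hausdorff_content_le)
    also have "\<dots> = (\<Sum>m. (\<lambda>(n, i). covering_cost k (C n i)) (prod_decode m))"
      by (intro arg_cong[where f=suminf] ext) (simp add: case_prod_beta)
    also have "\<dots> = (\<Sum>n. \<Sum>i. covering_cost k (C n i))"
      by (subst suminf_ennreal_2dimen[where g="\<lambda>n. \<Sum>i. covering_cost k (C n i)"]) auto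
    also have "\<dots> \<le> (\<Sum>n. hausdorff_content k \<delta> (A n) + ennreal (e * (1/2) ^ Suc n))"
      by (intro suminf_le less_imp_le[OF less]) auto
    also have "\<dots> = (\<Sum>n. hausdorff_content k \<delta> (A n)) + (\<Sum>n. ennreal (e * (1/2) ^ Suc n))"
      by (subst suminf_add) auto
    also have "(\<Sum>n. ennreal (e * (1/2) ^ Suc n)) = ennreal e"
      using sums_mult[OF power_half_series, of e] e
      by (intro suminf_ennreal_eq) auto
    finally show "hausdorff_content k \<delta> (\<Union>n. A n) \<le> (\<Sum>n. hausdorff_content k \<delta> (A n)) + ennreal e" .
  qed
qed

lemma hausdorff_outer_UN_le:
  "hausdorff_outer k (\<Union>n::nat. A n) \<le> (\<Sum>n. hausdorff_outer k (A n))"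
  by (intro hausdorff_outer_le order_trans[OF hausdorff_content_UN_le] suminf_le
        hausdorff_content_le_outer) auto

lemma hausdorff_outer_Un_le:
  "hausdorff_outer k (A \<union> B) \<le> hausdorff_outer k A + hausdorff_outer k B"
proof -
  let ?S = "\<lambda>n::nat. if n = 0 then A else if n = 1 then B else {}"
  have "(\<Union>n. ?S n) = A \<union> B" by (auto split: if_splits)
  then have "hausdorff_outer k (A \<union> B) \<le> (\<Sum>n. hausdorff_outer k (?S n))"
    using hausdorff_outer_UN_le[of k ?S] by simp
  also have "\<dots> = (\<Sum>n\<in>{0,1}. hausdorff_outer k (?S n))"
    by (intro suminf_finite) auto
  finally show ?thesis by simp
qed

text \<open>A covering set of diameter less than the distance of the two sets meets only one of them, so
  every sufficiently fine covering of the union splits into coverings of the parts.\<close>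

lemma hausdorff_outer_separated:
  assumes d: "0 < d" and sep: "\<And>x y. x \<in> A \<Longrightarrow> y \<in> B \<Longrightarrow> d \<le> dist x y"
  shows "hausdorff_outer k A + hausdorff_outer k B \<le> hausdorff_outer k (A \<union> B)"
proof -
  have *: "hausdorff_content k \<delta> A + hausdorff_content k \<delta> B \<le> hausdorff_content k \<delta> (A \<union> B)"
    if \<delta>: "0 < \<delta>" "\<delta> < d" for \<delta>
  proof (rule le_hausdorff_content)
    fix C assume C: "fine_cover \<delta> (A \<union> B) C"
    define restr where "restr S = (\<lambda>i. if C i \<inter> S = {} then {} else C i)" for S
    have "fine_cover \<delta> A (restr A)" "fine_cover \<delta> B (restr B)"
      using C \<delta> by (fastforce simp: fine_cover_def restr_def split: if_splits)+
    then have "hausdorff_content k \<delta> A + hausdorff_content k \<delta> B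
        \<le> (\<Sum>i. covering_cost k (restr A i)) + (\<Sum>i. covering_cost k (restr B i))"
      by (intro add_mono hausdorff_content_le)
    also have "\<dots> = (\<Sum>i. covering_cost k (restr A i) + covering_cost k (restr B i))"
      by (rule suminf_add) auto
    also have "\<dots> \<le> (\<Sum>i. covering_cost k (C i))"
    proof (intro suminf_le)
      fix i
      have "C i \<inter> A = {} \<or> C i \<inter> B = {}"
      proof (rule ccontr)
        assume "\<not> ?thesis"
        then obtain x y where "x \<in> C i" "x \<in> A" "y \<in> C i" "y \<in> B" by blast
        moreover have "bounded (C i)" "diameter (C i) \<le> \<delta>" using C by (auto simp: fine_cover_def)
        ultimately show False
          using diameter_bounded_bound[of "C i" x y] sep[of x y] \<delta> by linarith
      qed
      then show "covering_cost k (restr A i) + covering_cost k (restr B i) \<le> covering_cost k (C i)"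
        by (auto simp: restr_def)
    qed auto
    finally show "hausdorff_content k \<delta> A + hausdorff_content k \<delta> B
        \<le> (\<Sum>i. covering_cost k (C i))" .
  qed
  have "hausdorff_content k \<delta> A + hausdorff_content k \<epsilon> B \<le> hausdorff_outer k (A \<union> B)"
    if "0 < \<delta>" "0 < \<epsilon>" for \<delta> \<epsilon>
  proof -
    define m where "m = min (min \<delta> \<epsilon>) (d/2)"
    have m: "0 < m" "m < d" "m \<le> \<delta>" "m \<le> \<epsilon>" using that d by (auto simp: m_def)
    have "hausdorff_content k \<delta> A + hausdorff_content k \<epsilon> B
        \<le> hausdorff_content k m A + hausdorff_content k m B"
      using m by (intro add_mono hausdorff_content_mono) auto
    also have "\<dots> \<le> hausdorff_outer k (A \<union> B)"
      using *[OF m(1,2)] hausdorff_content_le_outer[OF m(1), of k "A \<union> B"] by (rule order_trans)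
    finally show ?thesis .
  qed
  then show ?thesis
    unfolding hausdorff_outer_def[of k A] hausdorff_outer_def[of k B]
    by (subst ennreal_SUP_add_left[symmetric], simp, intro SUP_least,
        subst ennreal_SUP_add_right, simp, intro SUP_least) auto
qed

lemma hausdorff_outer_separated_UN:
  fixes R :: "nat \<Rightarrow> 'a::metric_space set"
  assumes sep: "\<And>N. \<exists>d>0. \<forall>m<N. \<forall>x\<in>R m. \<forall>y\<in>R N. d \<le> dist x y"
    and sub: "\<And>m. R m \<subseteq> A"
  shows "(\<Sum>m<N. hausdorff_outer k (R m)) \<le> hausdorff_outer k A"
proof -
  have "(\<Sum>m<N. hausdorff_outer k (R m)) \<le> hausdorff_outer k (\<Union>m<N. R m)"
  proof (induction N)
    case (Suc N)
    obtain d where d: "d > 0" "\<And>m x y. m < N \<Longrightarrow> x \<in> R m \<Longrightarrow> y \<in> R N \<Longrightarrow> d \<le> dist x y"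
      using sep[of N] by blast
    have "(\<Sum>m<Suc N. hausdorff_outer k (R m))
        \<le> hausdorff_outer k (\<Union>m<N. R m) + hausdorff_outer k (R N)"
      using Suc by (simp add: add_right_mono)
    also have "\<dots> \<le> hausdorff_outer k ((\<Union>m<N. R m) \<union> R N)"
      using d by (intro hausdorff_outer_separated[of d]) auto
    also have "(\<Union>m<N. R m) \<union> R N = (\<Union>m<Suc N. R m)"
      by (auto simp: less_Suc_eq)
    finally show ?case .
  qed simp
  also have "\<dots> \<le> hausdorff_outer k A"
    using sub by (intro hausdorff_outer_mono) auto
  finally show ?thesis .
qed

lemma ennreal_le_add_tails:
  fixes x y :: ennreal and r :: "nat \<Rightarrow> ennreal"
  assumes "(\<Sum>k. r k) < top" and le: "\<And>n. x \<le> y + (\<Sum>k. r (k + n))"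
  shows "x \<le> y"
proof (rule ennreal_le_epsilon)
  fix e :: real assume e: "0 < e"
  have "r k < top" for k
    using assms(1) by (rule ennreal_suminf_lessD)
  define q where "q k = enn2real (r k)" for k
  have q: "r = (\<lambda>k. ennreal (q k))" "\<And>k. 0 \<le> q k"
    using \<open>\<And>k. r k < top\<close> by (auto simp: q_def)
  then have sq: "summable q"
    using assms(1) by (intro summable_suminf_not_top) (auto simp: less_top)
  then obtain N where N: "norm (\<Sum>i. q (i + N)) < e"
    using suminf_exist_split[OF e sq] by blast
  have "(\<Sum>k. r (k + N)) = ennreal (\<Sum>k. q (k + N))"
    unfolding q(1) using q(2) sq by (intro suminf_ennreal2) (auto simp: summable_iff_shift)
  also have "\<dots> \<le> ennreal e" using N by (intro ennreal_leI) auto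
  finally show "x \<le> y + ennreal e"
    using le[of N] by (meson add_left_mono order_trans)
qed

text \<open>Caratheodory's criterion for metric outer measures. The points of \<open>A\<close> at distance at least
  \<open>1 / (n + 1)\<close> from \<open>F\<close> are separated from \<open>A \<inter> F\<close>, so only the layers \<open>R k\<close> between
  consecutive distances, with \<open>k \<ge> n\<close>, are in the way. Layers of the same parity are separated
  from each other; hence the measures of all layers have a finite sum and the tails vanish.\<close>

lemma hausdorff_outer_caratheodory:
  fixes F A :: "'a::metric_space set"
  assumes F: "closed F"
  shows "hausdorff_outer k (A \<inter> F) + hausdorff_outer k (A - F) \<le> hausdorff_outer k A"
proof (cases "F = {} \<or> hausdorff_outer k A = top")
  case True
  then show ?thesis by auto
next
  case False
  then have ne: "F \<noteq> {}" and fin: "hausdorff_outer k A < top" by (auto simp: less_top)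
  define A' where "A' n = {x \<in> A. 1 / (real n + 1) \<le> infdist x F}" for n :: nat
  define R where "R n = {x \<in> A. 1 / (real n + 2) \<le> infdist x F \<and> infdist x F < 1 / (real n + 1)}" for n
  have near: "hausdorff_outer k (A \<inter> F) + hausdorff_outer k (A' n) \<le> hausdorff_outer k A" for n
  proof -
    have "hausdorff_outer k (A \<inter> F) + hausdorff_outer k (A' n) \<le> hausdorff_outer k ((A \<inter> F) \<union> A' n)"
    proof (rule hausdorff_outer_separated[of "1 / (real n + 1)"])
      fix x y assume "x \<in> A \<inter> F" "y \<in> A' n"
      then show "1 / (real n + 1) \<le> dist x y"
        using infdist_le[of x F y] by (auto simp: A'_def dist_commute)
    qed auto
    also have "\<dots> \<le> hausdorff_outer k A" by (intro hausdorff_outer_mono) (auto simp: A'_def)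
    finally show ?thesis .
  qed
  \<comment> \<open>For \<open>N = 0\<close> there is nothing to separate, and \<open>1 / real 0 = 0\<close> would make the gap negative when \<open>c = 0\<close>.\<close>
  have Rsep: "\<exists>d>0. \<forall>m<N. \<forall>x\<in>R (2*m+c). \<forall>y\<in>R (2*N+c). d \<le> dist x y" for N c
  proof (intro exI conjI allI impI ballI)
    let ?d = "1 / (real (2*N+c)) - 1 / (real (2*N+c) + 1)"
    have "0 < 1 / t - 1 / (t + 1)" if "0 < t" for t :: real
      using that by (simp add: frac_less2)
    from this[of "real (2*N+c)"] show "0 < (if N = 0 then 1 else ?d)" by auto
    fix m x y assume mN: "m < N" and x: "x \<in> R (2*m+c)" and y: "y \<in> R (2*N+c)"
    have "1 / real (2*N+c) \<le> 1 / (real (2*m+c) + 2)"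
      using mN by (intro divide_left_mono) auto
    also have "\<dots> \<le> infdist x F" using x by (simp add: R_def)
    finally have 1: "1 / real (2*N+c) \<le> infdist x F" .
    have "infdist y F < 1 / (real (2*N+c) + 1)" using y by (simp add: R_def)
    with 1 infdist_triangle[of x F y] mN
    show "(if N = 0 then 1 else ?d) \<le> dist x y" by simp
  qed
  have alt: "(\<Sum>m<N. hausdorff_outer k (R (2*m+c))) \<le> hausdorff_outer k A" for N c
    by (rule hausdorff_outer_separated_UN[OF Rsep]) (auto simp: R_def)
  have partial: "(\<Sum>m<N. hausdorff_outer k (R m)) \<le> hausdorff_outer k A + hausdorff_outer k A" for N
  proof -
    have "(\<Sum>m<N. hausdorff_outer k (R m)) \<le> (\<Sum>m<2*N. hausdorff_outer k (R m))"
      by (intro sum_mono2) auto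
    also have "\<dots> = (\<Sum>m<N. hausdorff_outer k (R (2*m+0))) + (\<Sum>m<N. hausdorff_outer k (R (2*m+1)))"
      by (induction N) (auto simp: ac_simps)
    also have "\<dots> \<le> hausdorff_outer k A + hausdorff_outer k A"
      by (intro add_mono alt)
    finally show ?thesis .
  qed
  have "(\<Sum>m. hausdorff_outer k (R m)) \<le> hausdorff_outer k A + hausdorff_outer k A"
    by (intro suminf_le_const[OF _ partial]) auto
  also have "\<dots> < top" using fin by simp
  finally have sum_fin: "(\<Sum>m. hausdorff_outer k (R m)) < top" .
  show ?thesis
  proof (rule ennreal_le_add_tails[OF sum_fin])
    fix n
    have "A - F \<subseteq> A' n \<union> (\<Union>i. R (i + n))"
    proof
      fix x assume x: "x \<in> A - F"
      then have pos: "0 < infdist x F"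
        using F ne in_closed_iff_infdist_zero infdist_nonneg[of x F] by (metis Diff_iff order_less_le)
      show "x \<in> A' n \<union> (\<Union>i. R (i + n))"
      proof (cases "1 / (real n + 1) \<le> infdist x F")
        case False
        obtain M where M: "1 / (real M + 1) < infdist x F"
          using pos reals_Archimedean[OF pos] by (auto simp: inverse_eq_divide add.commute)
        define j where "j = (LEAST j. 1 / (real j + 1) \<le> infdist x F)"
        have j1: "1 / (real j + 1) \<le> infdist x F"
          unfolding j_def using less_imp_le[OF M] by (rule LeastI[where P="\<lambda>j. 1 / (real j + 1) \<le> infdist x F" and k=M])
        have "n < j"
        proof (rule ccontr)
          assume "\<not> n < j"
          then have "1 / (real n + 1) \<le> 1 / (real j + 1)" by (intro divide_left_mono) auto
          with False j1 show False by linarith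
        qed
        then have "\<not> 1 / (real (j - 1) + 1) \<le> infdist x F"
          using not_less_Least[of "j - 1" "\<lambda>j. 1 / (real j + 1) \<le> infdist x F"] by (simp add: j_def)
        with j1 \<open>n < j\<close> x have "x \<in> R (j - 1)"
          by (auto simp: R_def of_nat_diff add.commute)
        then have "x \<in> R ((j - 1 - n) + n)" using \<open>n < j\<close> by simp
        then show ?thesis by blast
      qed (use x in \<open>auto simp: A'_def\<close>)
    qed
    then have "hausdorff_outer k (A - F) \<le> hausdorff_outer k (A' n \<union> (\<Union>i. R (i + n)))"
      by (rule hausdorff_outer_mono)
    also have "\<dots> \<le> hausdorff_outer k (A' n) + (\<Sum>i. hausdorff_outer k (R (i + n)))"
      by (rule order_trans[OF hausdorff_outer_Un_le]) (intro add_left_mono hausdorff_outer_UN_le)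
    finally have "hausdorff_outer k (A \<inter> F) + hausdorff_outer k (A - F)
        \<le> (hausdorff_outer k (A \<inter> F) + hausdorff_outer k (A' n)) + (\<Sum>i. hausdorff_outer k (R (i + n)))"
      by (simp add: add.assoc add_left_mono)
    also have "\<dots> \<le> hausdorff_outer k A + (\<Sum>i. hausdorff_outer k (R (i + n)))"
      by (intro add_right_mono near)
    finally show "hausdorff_outer k (A \<inter> F) + hausdorff_outer k (A - F)
        \<le> hausdorff_outer k A + (\<Sum>i. hausdorff_outer k (R (i + n)))" .
  qed
qed

lemma measure_space_hausdorff_outer:
  "measure_space UNIV (sets (borel :: 'a::metric_space measure)) (hausdorff_outer k)"
proof -
  interpret P: sigma_algebra UNIV "UNIV :: 'a set set"
    using sigma_algebra_Pow[of UNIV] by simp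
  have "outer_measure_space UNIV (hausdorff_outer k :: 'a set \<Rightarrow> ennreal)"
    by (auto simp: outer_measure_space_def positive_def increasing_def countably_subadditive_def
        intro: hausdorff_outer_mono hausdorff_outer_UN_le)
  then have ms: "measure_space UNIV (lambda_system UNIV UNIV (hausdorff_outer k :: 'a set \<Rightarrow> ennreal))
      (hausdorff_outer k)"
    by (rule P.caratheodory_lemma)
  then interpret L: sigma_algebra UNIV "lambda_system UNIV UNIV (hausdorff_outer k :: 'a set \<Rightarrow> ennreal)"
    by (simp add: measure_space_def)
  have "F \<in> lambda_system UNIV UNIV (hausdorff_outer k)" if "closed F" for F :: "'a set"
  proof -
    have "hausdorff_outer k (A \<inter> F) + hausdorff_outer k (A - F) = hausdorff_outer k A" for A
      using hausdorff_outer_caratheodory[OF that, of k A]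
        hausdorff_outer_Un_le[of k "A \<inter> F" "A - F"]
      by (simp add: Int_Diff_Un antisym)
    then show ?thesis by (simp add: P.lambda_system_eq)
  qed
  then have "sigma_sets UNIV (Collect closed) \<subseteq> lambda_system UNIV UNIV (hausdorff_outer k :: 'a set \<Rightarrow> ennreal)"
    by (intro L.sigma_sets_subset) auto
  then have sub: "sets borel \<subseteq> lambda_system UNIV UNIV (hausdorff_outer k :: 'a set \<Rightarrow> ennreal)"
    by (simp add: borel_eq_closed)
  have "countably_additive (sets (borel :: 'a measure)) (hausdorff_outer k)"
  proof (rule countably_additiveI)
    fix A :: "nat \<Rightarrow> 'a set"
    assume A: "range A \<subseteq> sets borel" "disjoint_family A" "(\<Union>i. A i) \<in> sets borel"
    have "countably_additive (lambda_system UNIV UNIV (hausdorff_outer k :: 'a set \<Rightarrow> ennreal))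
        (hausdorff_outer k)"
      using ms by (simp add: measure_space_def)
    moreover have "range A \<subseteq> lambda_system UNIV UNIV (hausdorff_outer k)"
      using A(1) sub by (rule order_trans)
    moreover have "(\<Union>i. A i) \<in> lambda_system UNIV UNIV (hausdorff_outer k)"
      using A(3) sub by (rule subsetD[rotated])
    ultimately show "(\<Sum>i. hausdorff_outer k (A i)) = hausdorff_outer k (\<Union>i. A i)"
      using A(2) by (simp add: countably_additive_def)
  qed
  then show ?thesis
    using sets.sigma_algebra_axioms[of "borel :: 'a measure"]
    by (simp add: measure_space_def positive_def)
qed

lemma sets_hausdorff_measure [simp, measurable_cong]: "sets (hausdorff_measure k) = sets borel"
  using sets.sigma_sets_eq[of borel] by (simp add: hausdorff_measure_def)

lemma space_hausdorff_measure [simp]: "space (hausdorff_measure k) = UNIV"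
  by (simp add: hausdorff_measure_def)

lemma emeasure_hausdorff_measure:
  assumes "A \<in> sets borel"
  shows "emeasure (hausdorff_measure k) A = hausdorff_outer k A"
proof (rule emeasure_measure_of[OF hausdorff_measure_def])
  show "positive (sets (hausdorff_measure k)) (hausdorff_outer k)"
    "countably_additive (sets (hausdorff_measure k)) (hausdorff_outer k)"
    using measure_space_hausdorff_outer[of k] unfolding sets_hausdorff_measure
    by (auto simp: measure_space_def)
qed (use assms in auto)

section \<open>Lipschitz maps and comparison with Lebesgue measure\<close>

lemma bounded_diameter_le:
  fixes S :: "'a::metric_space set"
  assumes "0 \<le> d" and "\<And>x y. x \<in> S \<Longrightarrow> y \<in> S \<Longrightarrow> dist x y \<le> d"
  shows "bounded S \<and> diameter S \<le> d"
proof
  show "bounded S" using assms by (auto simp: bounded_two_points)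
  show "diameter S \<le> d" using assms by (auto simp: diameter_def intro!: cSUP_least)
qed

lemma covering_cost_le:
  assumes "bounded C" "diameter C \<le> 2 * r"
  shows "covering_cost k C \<le> ennreal (unit_ball_vol (real k) * r ^ k)"
  using assms diameter_ge_0[of C]
  by (auto simp: covering_cost_def intro!: ennreal_leI mult_left_mono power_mono)

lemma hausdorff_outer_lipschitz:
  assumes lip: "\<And>x y. x \<in> A \<Longrightarrow> y \<in> A \<Longrightarrow> dist (\<phi> x) (\<phi> y) \<le> dist x y"
  shows "hausdorff_outer k (\<phi> ` A) \<le> hausdorff_outer k A"
proof (rule hausdorff_outer_le)
  fix \<delta> :: real assume \<delta>: "0 < \<delta>"
  have "hausdorff_content k \<delta> (\<phi> ` A) \<le> hausdorff_content k \<delta> A"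
  proof (rule le_hausdorff_content)
    fix C assume C: "fine_cover \<delta> A C"
    then have bC: "bounded (C i)" and dC: "diameter (C i) \<le> \<delta>" for i
      by (auto simp: fine_cover_def)
    let ?D = "\<lambda>i. \<phi> ` (C i \<inter> A)"
    have D: "bounded (?D i) \<and> diameter (?D i) \<le> diameter (C i)" for i
    proof (rule bounded_diameter_le)
      show "0 \<le> diameter (C i)" using bC by (rule diameter_ge_0)
      fix x y assume "x \<in> ?D i" "y \<in> ?D i"
      then obtain u v where "x = \<phi> u" "y = \<phi> v" "u \<in> C i \<inter> A" "v \<in> C i \<inter> A" by blast
      then show "dist x y \<le> diameter (C i)"
        using lip[of u v] diameter_bounded_bound[OF bC, of u i v] by auto
    qed
    have "fine_cover \<delta> (\<phi> ` A) ?D"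
      unfolding fine_cover_def
    proof (intro conjI allI)
      show "\<phi> ` A \<subseteq> (\<Union>i. ?D i)" using C unfolding fine_cover_def by blast
      show "bounded (?D i)" "diameter (?D i) \<le> \<delta>" for i
        using D[of i] dC[of i] by auto
    qed
    then have "hausdorff_content k \<delta> (\<phi> ` A) \<le> (\<Sum>i. covering_cost k (?D i))"
      by (rule hausdorff_content_le)
    also have "\<dots> \<le> (\<Sum>i. covering_cost k (C i))"
    proof (intro suminf_le)
      fix i
      show "covering_cost k (?D i) \<le> covering_cost k (C i)"
        using covering_cost_le[of "?D i" "diameter (C i) / 2" k] D[of i]
        by (cases "C i = {}") (auto simp: covering_cost_def)
    qed auto
    finally show "hausdorff_content k \<delta> (\<phi> ` A) \<le> (\<Sum>i. covering_cost k (C i))" .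
  qed
  also have "\<dots> \<le> hausdorff_outer k A" by (rule hausdorff_content_le_outer[OF \<delta>])
  finally show "hausdorff_content k \<delta> (\<phi> ` A) \<le> hausdorff_outer k A" .
qed

lemma hausdorff_content_finite_le:
  assumes "finite I" "A \<subseteq> (\<Union>i\<in>I. C i)" "0 \<le> \<delta>"
    and "\<And>i. i \<in> I \<Longrightarrow> bounded (C i) \<and> diameter (C i) \<le> \<delta>"
  shows "hausdorff_content k \<delta> A \<le> (\<Sum>i\<in>I. covering_cost k (C i))"
proof -
  obtain h where h: "bij_betw h {0..<card I} I"
    using ex_bij_betw_nat_finite[OF assms(1)] by blast
  let ?D = "\<lambda>n. if n < card I then C (h n) else {}"
  have hI: "h n \<in> I" if "n < card I" for n using h that by (auto simp: bij_betw_def)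
  have "x \<in> (\<Union>n. ?D n)" if x: "x \<in> A" for x
  proof -
    obtain i where i: "i \<in> I" "x \<in> C i" using assms(2) x by blast
    then obtain n where "n < card I" "i = h n"
      using h by (metis atLeastLessThan_iff bij_betw_iff_bijections)
    with i have "x \<in> ?D n" by simp
    then show ?thesis by blast
  qed
  moreover have "bounded (?D n) \<and> diameter (?D n) \<le> \<delta>" for n
    using assms(3,4) hI by auto
  ultimately have "fine_cover \<delta> A ?D" unfolding fine_cover_def by blast
  then have "hausdorff_content k \<delta> A \<le> (\<Sum>n. covering_cost k (?D n))"
    by (rule hausdorff_content_le)
  also have "\<dots> = (\<Sum>n\<in>{0..<card I}. covering_cost k (?D n))"
    by (rule suminf_finite) auto
  also have "\<dots> = (\<Sum>n\<in>{0..<card I}. covering_cost k (C (h n)))" by (rule sum.cong) auto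
  also have "\<dots> = (\<Sum>i\<in>I. covering_cost k (C i))" by (rule sum.reindex_bij_betw[OF h])
  finally show ?thesis .
qed

lemma hausdorff_outer_singleton: "hausdorff_outer 1 {x} = 0"
proof -
  have "hausdorff_outer 1 {x} \<le> 0"
  proof (rule hausdorff_outer_le)
    fix \<delta> :: real assume "0 < \<delta>"
    then have "hausdorff_content 1 \<delta> {x} \<le> (\<Sum>i\<in>{0::nat}. covering_cost 1 {x})"
      by (intro hausdorff_content_finite_le) auto
    then show "hausdorff_content 1 \<delta> {x} \<le> 0" by (simp add: covering_cost_def)
  qed
  then show ?thesis by simp
qed

lemma hausdorff_outer_interval_le:
  fixes a b :: real
  assumes "a \<le> b"
  shows "hausdorff_outer 1 {a..b} \<le> ennreal (b - a)"
proof (rule hausdorff_outer_le)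
  fix \<delta> :: real assume \<delta>: "0 < \<delta>"
  obtain m :: nat where m: "(b - a) / \<delta> < real m" using reals_Archimedean2 by blast
  define s where "s = (b - a) / real (Suc m)"
  define C where "C = (\<lambda>i::nat. {a + real i * s..a + (real i + 1) * s})"
  have s0: "0 \<le> s" using assms by (simp add: s_def)
  have "(b - a) < \<delta> * real (Suc m)"
    using m \<delta> by (simp add: field_simps)
  then have s\<delta>: "s \<le> \<delta>" by (simp add: s_def pos_divide_le_eq)
  have cover: "{a..a + real (Suc n) * s} \<subseteq> (\<Union>i\<in>{..<Suc n}. C i)" for n
  proof (induction n)
    case (Suc n)
    have "{a..a + real (Suc (Suc n)) * s} \<subseteq> {a..a + real (Suc n) * s} \<union> C (Suc n)"
      by (auto simp: C_def algebra_simps)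
    also have "\<dots> \<subseteq> (\<Union>i\<in>{..<Suc n}. C i) \<union> C (Suc n)" using Suc by blast
    also have "\<dots> = (\<Union>i\<in>{..<Suc (Suc n)}. C i)" by (auto simp: lessThan_Suc)
    finally show ?case .
  qed (auto simp: C_def)
  have bd: "bounded (C i) \<and> diameter (C i) \<le> s" for i
    using s0 by (intro bounded_diameter_le) (auto simp: C_def dist_real_def algebra_simps)
  have "{a..b} = {a..a + real (Suc m) * s}" by (simp add: s_def)
  then have "hausdorff_content 1 \<delta> {a..b} \<le> (\<Sum>i\<in>{..<Suc m}. covering_cost 1 (C i))"
    using cover[of m] bd s\<delta> \<delta> by (intro hausdorff_content_finite_le) (auto intro: order_trans)
  also have "\<dots> \<le> (\<Sum>i\<in>{..<Suc m}. ennreal s)"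
  proof (rule sum_mono)
    fix i show "covering_cost 1 (C i) \<le> ennreal s"
      using covering_cost_le[of "C i" "s/2" 1] bd[of i] by simp
  qed
  also have "\<dots> = ennreal (real (Suc m) * s)"
    using s0 by (simp add: ennreal_of_nat_eq_real_of_nat ennreal_mult'' del: of_nat_Suc)
  also have "real (Suc m) * s = b - a" by (simp add: s_def)
  finally show "hausdorff_content 1 \<delta> {a..b} \<le> ennreal (b - a)" .
qed

text \<open>The lower bound holds because a bounded set of reals is contained in an interval whose
  length is the diameter of the set.\<close>

lemma hausdorff_measure_1_real: "(hausdorff_measure 1 :: real measure) = lborel"
proof (rule lborel_eqI[symmetric])
  fix l u :: real assume "\<And>b. b \<in> Basis \<Longrightarrow> l \<bullet> b \<le> u \<bullet> b"
  then have lu: "l \<le> u" by simp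
  have "hausdorff_outer 1 {l<..<u} \<le> ennreal (u - l)"
    by (rule order_trans[OF hausdorff_outer_mono hausdorff_outer_interval_le[OF lu]]) auto
  moreover have "ennreal (u - l) \<le> hausdorff_outer 1 {l<..<u}"
  proof (rule order_trans[OF _ hausdorff_content_le_outer[of 1]], rule le_hausdorff_content)
    fix C :: "nat \<Rightarrow> real set" assume C: "fine_cover 1 {l<..<u} C"
    let ?D = "\<lambda>i. if C i = {} then {} else {Inf (C i)..Sup (C i)}"
    have bC: "bounded (C i)" for i using C by (auto simp: fine_cover_def)
    have "C i \<subseteq> ?D i" for i
      using bounded_imp_bdd_above[OF bC[of i]] bounded_imp_bdd_below[OF bC[of i]]
      by (auto intro: cInf_lower cSup_upper)
    then have "(\<Union>i. C i) \<subseteq> (\<Union>i. ?D i)" by (rule UN_mono[OF order_refl])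
    with C have "{l<..<u} \<subseteq> (\<Union>i. ?D i)" by (auto simp only: fine_cover_def intro: order_trans)
    then have "emeasure lborel {l<..<u} \<le> emeasure lborel (\<Union>i. ?D i)"
      by (intro emeasure_mono) auto
    also have "\<dots> \<le> (\<Sum>i. emeasure lborel (?D i))"
      by (intro emeasure_subadditive_countably) auto
    also have "\<dots> \<le> (\<Sum>i. covering_cost 1 (C i))"
    proof (intro suminf_le)
      fix i
      show "emeasure lborel (?D i) \<le> covering_cost 1 (C i)"
      proof (cases "C i = {}")
        case False
        have "Sup (C i) \<le> Inf (C i) + diameter (C i)"
        proof (rule cSup_least[OF False])
          fix x assume x: "x \<in> C i"
          have "x - diameter (C i) \<le> Inf (C i)"
          proof (rule cInf_greatest[OF False])
            fix y assume "y \<in> C i"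
            with x diameter_bounded_bound[OF bC, of x i y]
            show "x - diameter (C i) \<le> y" by (simp add: dist_real_def)
          qed
          then show "x \<le> Inf (C i) + diameter (C i)" by simp
        qed
        moreover have "Inf (C i) \<le> Sup (C i)"
          using False bounded_imp_bdd_above[OF bC] bounded_imp_bdd_below[OF bC]
          by (intro cInf_le_cSup) auto
        ultimately show ?thesis
          using False by (auto simp: covering_cost_def intro!: ennreal_leI)
      qed simp
    qed auto
    finally show "ennreal (u - l) \<le> (\<Sum>i. covering_cost 1 (C i))" using lu by simp
  qed simp
  ultimately have "hausdorff_outer 1 {l<..<u} = ennreal (u - l)" by (rule antisym)
  then show "emeasure (hausdorff_measure 1) (box l u) = ennreal (\<Prod>b\<in>Basis. (u - l) \<bullet> b)"
    by (simp add: emeasure_hausdorff_measure)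
qed simp

text \<open>A reflection in a point is an isometric involution, so the Lipschitz bound applies in both
  directions.\<close>

lemma hausdorff_measure_reflect:
  fixes c :: "'a::real_normed_vector"
  shows "distr (hausdorff_measure k) borel (\<lambda>x. c - x) = hausdorff_measure k"
proof (rule measure_eqI)
  fix A assume "A \<in> sets (distr (hausdorff_measure k) borel (\<lambda>x. c - x))"
  then have A: "A \<in> sets borel" by simp
  have meas: "(\<lambda>x. c - x) \<in> borel \<rightarrow>\<^sub>M (borel :: 'a measure)"
    by (intro borel_measurable_continuous_onI continuous_intros)
  have le: "hausdorff_outer k ((\<lambda>x. c - x) ` B) \<le> hausdorff_outer k B" for B
    by (rule hausdorff_outer_lipschitz) (simp add: dist_norm norm_minus_commute)
  have vim: "(\<lambda>x. c - x) -` A = (\<lambda>x. c - x) ` A"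
    by (auto simp: image_iff) (metis diff_diff_eq2 add_diff_cancel_left')
  have "(\<lambda>x. c - x) ` (\<lambda>x. c - x) ` A = A" by (auto simp: image_image)
  then have "hausdorff_outer k ((\<lambda>x. c - x) ` A) = hausdorff_outer k A"
    using le[of A] le[of "(\<lambda>x. c - x) ` A"] by simp
  moreover have "(\<lambda>x. c - x) -` A \<in> sets borel"
    using measurable_sets[OF meas A] by simp
  ultimately show "emeasure (distr (hausdorff_measure k) borel (\<lambda>x. c - x)) A
      = emeasure (hausdorff_measure k) A"
    using A meas by (simp add: emeasure_distr emeasure_hausdorff_measure vim)
qed simp

text \<open>A crude comparison, losing the factor \<open>4\<close> by enclosing each covering set in a disc whose radius
  is its diameter. Its only purpose is that \<open>\<H>\<^sup>2\<close> is not the null measure.\<close>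

lemma lborel_le_hausdorff_2:
  fixes A :: "(real ^ 2) set"
  assumes A: "A \<in> sets borel"
  shows "emeasure lborel A \<le> 4 * emeasure (hausdorff_measure 2) A"
proof -
  have "emeasure lborel A \<le> 4 * hausdorff_content 2 1 A"
  proof -
    have "emeasure lborel A \<le> 4 * (\<Sum>i. covering_cost 2 (C i))"
      if C: "fine_cover 1 A C" for C :: "nat \<Rightarrow> (real ^ 2) set"
    proof -
      have bC: "bounded (C i)" for i using C by (simp add: fine_cover_def)
      define D where "D i = (if C i = {} then {} else cball (SOME x. x \<in> C i) (diameter (C i)))" for i
      have CD: "C i \<subseteq> D i" for i
      proof (cases "C i = {}")
        case False
        then have "(SOME x. x \<in> C i) \<in> C i" by (simp add: some_in_eq)
        then show ?thesis
          using diameter_bounded_bound[OF bC[of i]] by (auto simp: D_def)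
      qed simp
      have "A \<subseteq> (\<Union>i. C i)" using C by (simp add: fine_cover_def)
      also have "\<dots> \<subseteq> (\<Union>i. D i)" using CD by (rule UN_mono[OF order_refl])
      finally have "emeasure lborel A \<le> emeasure lborel (\<Union>i. D i)"
        by (intro emeasure_mono) (auto simp: D_def)
      also have "\<dots> \<le> (\<Sum>i. emeasure lborel (D i))"
        by (intro emeasure_subadditive_countably) (auto simp: D_def)
      also have "\<dots> \<le> (\<Sum>i. 4 * covering_cost 2 (C i))"
      proof (intro suminf_le)
        fix i
        have "emeasure lborel (D i) = ennreal (4 * (unit_ball_vol 2 * (diameter (C i) / 2)^2))"
          if "C i \<noteq> {}"
          using that diameter_ge_0[OF bC[of i]] by (simp add: D_def emeasure_cball power2_eq_square)
        then show "emeasure lborel (D i) \<le> 4 * covering_cost 2 (C i)"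
          by (cases "C i = {}") (auto simp: D_def covering_cost_def ennreal_mult)
      qed auto
      finally show ?thesis by simp
    qed
    then have "emeasure lborel A / 4 \<le> hausdorff_content 2 1 A"
      by (intro le_hausdorff_content divide_le_posI_ennreal) auto
    then have "4 * (emeasure lborel A / 4) \<le> 4 * hausdorff_content 2 1 A"
      by (rule mult_left_mono) simp
    moreover have "4 * (emeasure lborel A / 4) = emeasure lborel A"
      by (simp add: ennreal_times_divide ennreal_mult_divide_eq mult.commute[of 4])
    ultimately show ?thesis by simp
  qed
  also have "\<dots> \<le> 4 * hausdorff_outer 2 A"
    by (intro mult_left_mono hausdorff_content_le_outer) auto
  finally show ?thesis using A by (simp add: emeasure_hausdorff_measure)
qed

lemma dist_vec2_le: "dist (x :: real ^ 2) y \<le> \<bar>x $ 1 - y $ 1\<bar> + \<bar>x $ 2 - y $ 2\<bar>"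
  using norm_le_l1_cart[of "x - y"] by (simp add: dist_norm sum_2)

text \<open>Cover by the squares of a fine grid: their number and the squares of their diameters
  compensate each other.\<close>

lemma hausdorff_outer_cube_finite:
  fixes N :: nat
  shows "hausdorff_outer 2 {p :: real ^ 2. \<forall>i. \<bar>p $ i\<bar> \<le> real N} < top"
    (is "hausdorff_outer 2 ?Q < top")
proof -
  have "hausdorff_outer 2 ?Q \<le> ennreal (pi * (2 * real N + 1)^2)"
  proof (rule hausdorff_outer_le)
    fix \<delta> :: real assume \<delta>: "0 < \<delta>"
    obtain m :: nat where "max 1 (2 / \<delta>) < real m" using reals_Archimedean2 by blast
    then have m: "1 \<le> real m" "2 / real m \<le> \<delta>" "0 < real m"
      using \<delta> by (auto simp: field_simps)
    define J where "J = {- int (N * m)..int (N * m)}"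
    define C where "C = (\<lambda>(a, b). {p :: real ^ 2. \<lfloor>p $ 1 * m\<rfloor> = a \<and> \<lfloor>p $ 2 * m\<rfloor> = b})"
    have close: "\<bar>s - t\<bar> \<le> 1 / real m" if "\<lfloor>s * m\<rfloor> = \<lfloor>t * m\<rfloor>" for s t :: real
    proof -
      have "\<bar>s * m - t * m\<bar> \<le> 1" using that by linarith
      then have "\<bar>s - t\<bar> * m \<le> 1" using m(3) by (simp add: abs_mult left_diff_distrib[symmetric])
      then show ?thesis using m(3) by (simp add: field_simps)
    qed
    have bd: "bounded (C i) \<and> diameter (C i) \<le> 2 / real m" for i
    proof (rule bounded_diameter_le)
      fix x y assume "x \<in> C i" "y \<in> C i"
      then have "\<bar>x $ 1 - y $ 1\<bar> \<le> 1 / real m" "\<bar>x $ 2 - y $ 2\<bar> \<le> 1 / real m"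
        by (auto simp: C_def split: prod.splits intro!: close)
      then show "dist x y \<le> 2 / real m" using dist_vec2_le[of x y] by simp
    qed simp
    have fl: "\<lfloor>t * m\<rfloor> \<in> J" if "\<bar>t\<bar> \<le> real N" for t :: real
    proof -
      have "\<bar>t * m\<bar> \<le> real (N * m)" using that m(3) by (simp add: abs_mult)
      then show ?thesis by (auto simp: J_def floor_le_iff le_floor_iff abs_le_iff)
    qed
    have "?Q \<subseteq> (\<Union>i\<in>J \<times> J. C i)"
    proof
      fix p :: "real ^ 2" assume "p \<in> ?Q"
      then have "(\<lfloor>p $ 1 * m\<rfloor>, \<lfloor>p $ 2 * m\<rfloor>) \<in> J \<times> J" by (auto intro: fl)
      moreover have "p \<in> C (\<lfloor>p $ 1 * m\<rfloor>, \<lfloor>p $ 2 * m\<rfloor>)" by (simp add: C_def)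
      ultimately show "p \<in> (\<Union>i\<in>J \<times> J. C i)" by blast
    qed
    then have "hausdorff_content 2 \<delta> ?Q \<le> (\<Sum>i\<in>J \<times> J. covering_cost 2 (C i))"
      using bd m(2) \<delta> by (intro hausdorff_content_finite_le conjI order_trans[OF _ m(2)]) (auto simp: J_def)
    also have "\<dots> \<le> (\<Sum>i\<in>J \<times> J. ennreal (pi * (1 / real m)^2))"
    proof (rule sum_mono)
      fix i show "covering_cost 2 (C i) \<le> ennreal (pi * (1 / real m)^2)"
        using covering_cost_le[of "C i" "1 / real m" 2] bd[of i] by (simp add: unit_ball_vol_2)
    qed
    also have "\<dots> = ennreal (real (card (J \<times> J)) * (pi * (1 / real m)^2))"
      by (simp add: ennreal_of_nat_eq_real_of_nat ennreal_mult'')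
    also have "\<dots> \<le> ennreal (pi * (2 * real N + 1)^2)"
    proof (rule ennreal_leI)
      have "real (card J) = 2 * real N * real m + 1" by (simp add: J_def)
      also have "\<dots> \<le> (2 * real N + 1) * real m" using m(1) by (simp add: algebra_simps)
      finally have "real (card J) / real m \<le> 2 * real N + 1" using m(3) by (simp add: pos_divide_le_eq)
      then have "(real (card J) / real m)^2 \<le> (2 * real N + 1)^2" by (intro power_mono) auto
      then have "pi * (real (card J) / real m)^2 \<le> pi * (2 * real N + 1)^2" by simp
      moreover have "real (card (J \<times> J)) * (pi * (1 / real m)^2) = pi * (real (card J) / real m)^2"
        by (simp add: card_cartesian_product power2_eq_square mult_ac)
      ultimately show "real (card (J \<times> J)) * (pi * (1 / real m)^2) \<le> pi * (2 * real N + 1)^2"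
        by simp
    qed
    finally show "hausdorff_content 2 \<delta> ?Q \<le> ennreal (pi * (2 * real N + 1)^2)" .
  qed
  then show ?thesis by (simp add: le_less_trans)
qed

text \<open>Uniqueness of invariant measures by Fubini. Integrating \<open>1\<^sub>A(x) 1\<^sub>B(y - x)\<close> with respect to
  \<open>\<H>\<^sup>2(dx) dy\<close> gives \<open>\<H>\<^sup>2(A) |B|\<close> by translation invariance of Lebesgue measure; the substitution
  of \<open>y - x\<close> for \<open>x\<close>, which preserves \<open>\<H>\<^sup>2\<close>, turns it into \<open>|A| \<H>\<^sup>2(B)\<close>.\<close>

lemma hausdorff_measure_2_eq:
  obtains \<kappa> where "0 < \<kappa>" "(hausdorff_measure 2 :: (real ^ 2) measure) = density lborel (\<lambda>_. ennreal \<kappa>)"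
proof -
  let ?H = "hausdorff_measure 2 :: (real ^ 2) measure"
  let ?Q = "\<lambda>N::nat. {p :: real ^ 2. \<forall>i. \<bar>p $ i\<bar> \<le> real N}"
  have Q: "?Q N \<in> sets borel" for N
    by (intro borel_closed closed_Collect_all closed_Collect_le continuous_intros)
  have Qfin: "emeasure ?H (?Q N) < top" for N
    using hausdorff_outer_cube_finite[of N] Q by (simp add: emeasure_hausdorff_measure)
  have "(\<Union>N. ?Q N) = UNIV"
  proof (intro set_eqI iffI UNIV_I)
    fix p :: "real ^ 2"
    obtain N :: nat where "norm p < real N" using reals_Archimedean2 by blast
    then have "p \<in> ?Q N" using component_le_norm_cart[of p] by (auto intro: order_trans less_imp_le)
    then show "p \<in> (\<Union>N. ?Q N)" by blast
  qed
  then have "sigma_finite_measure ?H"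
    using Q Qfin by (intro sigma_finite_measure.intro exI[of _ "range ?Q"]) (auto simp: less_top)
  then interpret H: sigma_finite_measure ?H .
  interpret HL: pair_sigma_finite ?H "lborel :: (real ^ 2) measure" ..
  have swap: "emeasure ?H A * emeasure lborel B = emeasure lborel A * emeasure ?H B"
    if [measurable]: "A \<in> sets borel" "B \<in> sets borel" for A B :: "(real ^ 2) set"
  proof -
    have shift: "(\<integral>\<^sup>+y. indicator S (y - x) \<partial>lborel) = emeasure lborel S"
      if [measurable]: "S \<in> sets borel" for S and x :: "real ^ 2"
    proof -
      have "(\<integral>\<^sup>+y. indicator S (y - x) \<partial>lborel) = (\<integral>\<^sup>+y. indicator S (y - x) \<partial>distr lborel borel ((+) x))"
        by (simp add: lborel_distr_plus)
      also have "\<dots> = (\<integral>\<^sup>+y. indicator S y \<partial>lborel)"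
        by (subst nn_integral_distr) auto
      finally show ?thesis by simp
    qed
    have refl: "(\<integral>\<^sup>+x. indicator A x * indicator B (y - x) \<partial>?H)
        = (\<integral>\<^sup>+x. indicator A (y - x) * indicator B x \<partial>?H)" for y :: "real ^ 2"
    proof -
      have "(\<integral>\<^sup>+x. indicator A x * indicator B (y - x) \<partial>?H)
          = (\<integral>\<^sup>+x. indicator A x * indicator B (y - x) \<partial>distr ?H borel (\<lambda>x. y - x))"
        by (simp add: hausdorff_measure_reflect)
      also have "\<dots> = (\<integral>\<^sup>+x. indicator A (y - x) * indicator B x \<partial>?H)"
        by (subst nn_integral_distr) auto
      finally show ?thesis .
    qed
    have "emeasure ?H A * emeasure lborel B
        = (\<integral>\<^sup>+x. (\<integral>\<^sup>+y. indicator A x * indicator B (y - x) \<partial>lborel) \<partial>?H)"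
      by (simp add: nn_integral_cmult shift nn_integral_multc)
    also have "\<dots> = (\<integral>\<^sup>+y. (\<integral>\<^sup>+x. indicator A x * indicator B (y - x) \<partial>?H) \<partial>lborel)"
      by (rule HL.Fubini'[symmetric]) measurable
    also have "\<dots> = (\<integral>\<^sup>+y. (\<integral>\<^sup>+x. indicator A (y - x) * indicator B x \<partial>?H) \<partial>lborel)"
      by (simp add: refl)
    also have "\<dots> = (\<integral>\<^sup>+x. (\<integral>\<^sup>+y. indicator A (y - x) * indicator B x \<partial>lborel) \<partial>?H)"
      by (rule HL.Fubini') measurable
    also have "\<dots> = emeasure lborel A * emeasure ?H B"
      by (simp add: nn_integral_multc shift nn_integral_cmult)
    finally show ?thesis .
  qed
  let ?B = "cball 0 1 :: (real ^ 2) set"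
  have "?B \<subseteq> ?Q 1" using component_le_norm_cart by (fastforce intro: order_trans)
  then have "emeasure ?H ?B \<le> emeasure ?H (?Q 1)" by (intro emeasure_mono) (use Q[of 1] in auto)
  then have Bfin: "emeasure ?H ?B < top" using Qfin[of 1] by (rule le_less_trans)
  have lB: "emeasure lborel ?B = ennreal pi" by (simp add: emeasure_cball unit_ball_vol_2)
  define \<kappa> where "\<kappa> = measure ?H ?B / pi"
  have HB: "emeasure ?H ?B = ennreal (\<kappa> * pi)"
    using Bfin by (simp add: \<kappa>_def emeasure_eq_ennreal_measure less_top)
  have "ennreal pi \<le> 4 * emeasure ?H ?B"
    using lborel_le_hausdorff_2[of ?B] by (simp add: lB)
  then have "\<kappa> \<noteq> 0" by (auto simp: HB)
  moreover have "0 \<le> \<kappa>" by (simp add: \<kappa>_def)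
  ultimately have "0 < \<kappa>" by simp
  moreover have "?H = density lborel (\<lambda>_. ennreal \<kappa>)"
  proof (rule measure_eqI)
    fix A assume "A \<in> sets ?H"
    then have A: "A \<in> sets borel" by simp
    have "emeasure ?H A * ennreal pi = (ennreal \<kappa> * emeasure lborel A) * ennreal pi"
      using swap[of A ?B] A \<open>0 \<le> \<kappa>\<close> by (simp add: lB HB ennreal_mult ac_simps)
    then have "emeasure ?H A = ennreal \<kappa> * emeasure lborel A"
      by (simp add: ennreal_mult_cancel_left[of "ennreal pi"] mult.commute[of _ "ennreal pi"])
    also have "\<dots> = emeasure (density lborel (\<lambda>_. ennreal \<kappa>)) A"
      using A by (simp add: emeasure_density_const)
    finally show "emeasure ?H A = emeasure (density lborel (\<lambda>_. ennreal \<kappa>)) A" .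
  qed simp
  ultimately show ?thesis by (rule that)
qed

section \<open>Coordinates and projections of the plane\<close>

lemma open_convex_real_eq:
  fixes S :: "real set"
  assumes "open S" "convex S" "bounded S" "S \<noteq> {}"
  shows "S = {Inf S<..<Sup S}"
proof (intro set_eqI iffI)
  fix x assume x: "x \<in> S"
  obtain e where e: "0 < e" "cball x e \<subseteq> S" using assms(1) x by (auto simp: open_contains_cball)
  then have "x - e \<in> S" "x + e \<in> S" by (auto simp: dist_real_def subset_iff)
  then have "Inf S \<le> x - e" "x + e \<le> Sup S"
    using bounded_imp_bdd_below[OF assms(3)] bounded_imp_bdd_above[OF assms(3)]
    by (auto intro: cInf_lower cSup_upper)
  with e(1) show "x \<in> {Inf S<..<Sup S}" by auto
next
  fix x assume "x \<in> {Inf S<..<Sup S}"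
  then have "Inf S < x" "x < Sup S" by auto
  then obtain a b where "a \<in> S" "a < x" "b \<in> S" "x < b"
    using cInf_lessD[OF assms(4)] less_cSupD[OF assms(4)] by blast
  moreover have "is_interval S" using assms(2) by (simp add: is_interval_convex_1)
  ultimately show "x \<in> S" by (meson less_imp_le mem_is_interval_1_I)
qed

text \<open>The direction \<open>i\<close> of the first coordinate is a parameter, so that the two coordinates can be
  exchanged later without loss of generality.\<close>

definition plane_point :: "2 \<Rightarrow> real \<Rightarrow> real \<Rightarrow> real ^ 2" where
  "plane_point i t y = (\<chi> k. if k = i then t else y)"

lemma plane_point_nth [simp]:
  "plane_point i t y $ i = t" "j \<noteq> i \<Longrightarrow> plane_point i t y $ j = y"
  by (auto simp: plane_point_def)

lemma UNIV_2_eq: "i \<noteq> j \<Longrightarrow> (UNIV :: 2 set) = {i, j}"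
  using exhaust_2 by (metis (full_types) UNIV_2 doubleton_eq_iff insert_commute insertE insertI1 singletonD UNIV_I)

lemma
  assumes "i \<noteq> (j :: 2)"
  shows all_2_iff: "(\<forall>k. P k) \<longleftrightarrow> P i \<and> P j"
    and sum_UNIV_2: "(\<Sum>k\<in>UNIV. f k) = f i + f j"
    and prod_UNIV_2: "(\<Prod>k\<in>UNIV. h k) = h i * h j"
proof -
  show "(\<forall>k. P k) \<longleftrightarrow> P i \<and> P j"
    using UNIV_2_eq[OF assms] by (metis UNIV_I insertE singletonD)
qed (unfold UNIV_2_eq[OF assms], use assms in auto)

lemma plane_point_eta: "i \<noteq> j \<Longrightarrow> plane_point i (p $ i) (p $ j) = p"
  using UNIV_2_eq[of i j] by (auto simp: plane_point_def vec_eq_iff)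

lemma plane_point_affine:
  "plane_point i ((1 - u) * s + u * t) ((1 - u) * x + u * y)
    = (1 - u) *\<^sub>R plane_point i s x + u *\<^sub>R plane_point i t y"
  by (simp add: plane_point_def vec_eq_iff)

lemma continuous_on_plane_point [continuous_intros]:
  assumes "continuous_on S f" "continuous_on S g"
  shows "continuous_on S (\<lambda>x. plane_point i (f x) (g x))"
  unfolding plane_point_def
proof (rule continuous_on_vec_lambda)
  fix k show "continuous_on S (\<lambda>x. if k = i then f x else g x)" using assms by (cases "k = i") auto
qed

lemma borel_measurable_plane_point [measurable]:
  assumes [measurable]: "f \<in> borel_measurable M" "g \<in> borel_measurable M"
  shows "(\<lambda>x. plane_point i (f x) (g x)) \<in> borel_measurable M"
proof -
  have "continuous_on UNIV (\<lambda>p. plane_point i (fst p) (snd p))"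
    by (intro continuous_intros)
  then have "(\<lambda>p. plane_point i (fst p) (snd p)) \<in> borel_measurable (borel :: (real \<times> real) measure)"
    by (rule borel_measurable_continuous_onI)
  then have "(\<lambda>x. (\<lambda>p. plane_point i (fst p) (snd p)) (f x, g x)) \<in> borel_measurable M"
    by (rule measurable_compose[rotated]) (simp add: borel_prod[symmetric])
  then show ?thesis by simp
qed

lemma dist_plane_point:
  "dist (plane_point i s x) (plane_point i s y) = dist x y"
  "dist (plane_point i s x) (plane_point i t x) = dist s t"
proof -
  obtain j where U: "i \<noteq> j" "j \<noteq> i" using exhaust_2 by (metis one_neq_zero zero_neq_one)
  show "dist (plane_point i s x) (plane_point i s y) = dist x y"
    "dist (plane_point i s x) (plane_point i t x) = dist s t"
    using U by (simp_all add: dist_vec_def L2_set_def sum_UNIV_2[OF U(1)])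
qed

lemma lborel_plane:
  "distr lborel borel (\<lambda>(t, y). plane_point i t y) = (lborel :: (real ^ 2) measure)"
proof (rule lborel_eqI[symmetric])
  obtain j where ij: "i \<noteq> j" using exhaust_2 by (metis one_neq_zero zero_neq_one)
  fix l u :: "real ^ 2" assume le: "\<And>b. b \<in> Basis \<Longrightarrow> l \<bullet> b \<le> u \<bullet> b"
  have le': "l $ k \<le> u $ k" for k
    using le[of "axis k 1"] by (simp add: axis_in_Basis_iff inner_axis)
  have [measurable]: "(\<lambda>(t, y). plane_point i t y) \<in> borel_measurable (borel :: (real \<times> real) measure)"
    unfolding case_prod_beta by (intro borel_measurable_continuous_onI continuous_intros)
  have "(\<lambda>(t, y). plane_point i t y) -` box l u = {l $ i<..<u $ i} \<times> {l $ j<..<u $ j}"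
    using ij by (auto simp: mem_box_cart all_2_iff[OF ij])
  moreover have "emeasure lborel ({l $ i<..<u $ i} \<times> {l $ j<..<u $ j})
      = ennreal (u $ i - l $ i) * ennreal (u $ j - l $ j)"
    using le' by (simp add: lborel_prod[symmetric] lborel.emeasure_pair_measure_Times)
  moreover have "(\<Prod>b\<in>Basis. (u - l) \<bullet> b) = (\<Prod>k\<in>UNIV. (u - l) $ k)"
  proof -
    have B: "(Basis :: (real ^ 2) set) = (\<lambda>k. axis k 1) ` UNIV"
      by (auto simp: Basis_vec_def)
    show ?thesis
      unfolding B by (subst prod.reindex) (auto simp: inj_on_def axis_eq_axis inner_axis)
  qed
  ultimately show "emeasure (distr lborel borel (\<lambda>(t, y). plane_point i t y)) (box l u)
      = ennreal (\<Prod>b\<in>Basis. (u - l) \<bullet> b)"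
    using ij le' by (simp add: emeasure_distr ennreal_mult prod_UNIV_2[OF ij])
qed simp

lemma nn_integral_plane:
  assumes [measurable]: "g \<in> borel_measurable borel"
  shows "(\<integral>\<^sup>+p. g p \<partial>lborel) = (\<integral>\<^sup>+t. \<integral>\<^sup>+y. g (plane_point i t y) \<partial>lborel \<partial>lborel)"
proof -
  have [measurable]: "(\<lambda>(t, y). plane_point i t y) \<in> borel_measurable (borel :: (real \<times> real) measure)"
    unfolding case_prod_beta by (intro borel_measurable_continuous_onI continuous_intros)
  have "(\<integral>\<^sup>+p. g p \<partial>lborel) = (\<integral>\<^sup>+q. g ((\<lambda>(t, y). plane_point i t y) q) \<partial>lborel)"
    by (subst lborel_plane[of i, symmetric]) (simp add: nn_integral_distr)
  also have "\<dots> = (\<integral>\<^sup>+q. g ((\<lambda>(t, y). plane_point i t y) q) \<partial>(lborel \<Otimes>\<^sub>M lborel))"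
    by (simp add: lborel_prod)
  also have "\<dots> = (\<integral>\<^sup>+t. \<integral>\<^sup>+y. g (plane_point i t y) \<partial>lborel \<partial>lborel)"
    by (subst lborel.nn_integral_fst[symmetric]) (simp_all add: case_prod_beta)
  finally show ?thesis .
qed

lemma emeasure_le_hausdorff_1:
  fixes E :: "(real ^ 2) set"
  assumes "S \<in> sets borel" "E \<in> sets borel" "S \<subseteq> (\<lambda>p. p $ i) ` E"
  shows "emeasure lborel S \<le> emeasure (hausdorff_measure 1) E"
proof -
  have "emeasure lborel S = hausdorff_outer 1 S"
    using assms(1) by (simp add: emeasure_hausdorff_measure flip: hausdorff_measure_1_real)
  also have "\<dots> \<le> hausdorff_outer 1 ((\<lambda>p. p $ i) ` E)"
    using assms(3) by (rule hausdorff_outer_mono)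
  also have "\<dots> \<le> hausdorff_outer 1 E"
    by (rule hausdorff_outer_lipschitz) (simp add: dist_vec_nth_le)
  finally show ?thesis using assms(2) by (simp add: emeasure_hausdorff_measure)
qed

text \<open>The push-forward of Lebesgue measure under a section \<open>T\<close> of the projection is dominated by
  \<open>\<H>\<^sup>1\<close> on its range, because a set of parameters is the projection of its image.\<close>

lemma nn_integral_le_hausdorff_1:
  fixes T :: "real \<Rightarrow> real ^ 2"
  assumes [measurable]: "T \<in> borel_measurable borel" "I \<in> sets borel" "G \<in> sets borel"
      "h \<in> borel_measurable borel"
    and T: "\<And>t. t \<in> I \<Longrightarrow> T t \<in> G \<and> T t $ i = t"
  shows "(\<integral>\<^sup>+t. indicator I t * h (T t) \<partial>lborel) \<le> (\<integral>\<^sup>+p. indicator G p * h p \<partial>hausdorff_measure 1)"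
proof -
  let ?M = "distr (density lborel (indicator I)) borel T"
  let ?N = "density (hausdorff_measure 1) (indicator G)"
  have "(\<integral>\<^sup>+t. indicator I t * h (T t) \<partial>lborel) = (\<integral>\<^sup>+p. h p \<partial>?M)"
    by (simp add: nn_integral_distr nn_integral_density)
  also have "\<dots> \<le> (\<integral>\<^sup>+p. h p \<partial>?N)"
  proof (rule nn_integral_mono_measure)
    show "?M \<le> ?N"
    proof (subst le_measure, simp, intro ballI)
      fix E assume "E \<in> sets ?M"
      then have [measurable]: "E \<in> sets borel" by simp
      have "emeasure ?M E = emeasure lborel (I \<inter> T -` E)"
        using measurable_sets[of T borel borel E]
        by (simp add: emeasure_distr emeasure_density indicator_inter_arith[symmetric] nn_integral_indicator)
      also have "\<dots> \<le> emeasure (hausdorff_measure 1) (G \<inter> E)"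
      proof (rule emeasure_le_hausdorff_1)
        show "I \<inter> T -` E \<in> sets borel"
          using measurable_sets[of T borel borel E] by simp
        show "I \<inter> T -` E \<subseteq> (\<lambda>p. p $ i) ` (G \<inter> E)"
        proof
          fix t assume "t \<in> I \<inter> T -` E"
          then show "t \<in> (\<lambda>p. p $ i) ` (G \<inter> E)"
            using T[of t] by (intro image_eqI[of _ _ "T t"]) auto
        qed
      qed simp
      also have "\<dots> = emeasure ?N E"
        by (simp add: emeasure_density indicator_inter_arith[symmetric] nn_integral_indicator)
      finally show "emeasure ?M E \<le> emeasure ?N E" .
    qed
  qed simp
  also have "\<dots> = (\<integral>\<^sup>+p. indicator G p * h p \<partial>hausdorff_measure 1)"
    by (simp add: nn_integral_density)
  finally show ?thesis .
qed

section \<open>Convex functions on lines and on bounded sets\<close>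

lemma nn_integral_chord:
  fixes l u a b :: real
  assumes lu: "l < u" and ab: "0 \<le> a" "0 \<le> b"
  shows "(\<integral>\<^sup>+y. ennreal (((u - y) * a + (y - l) * b) / (u - l)) * indicator {l..u} y \<partial>lborel)
    = ennreal ((u - l) / 2 * (a + b))"
proof -
  define k where "k = 1 / (u - l)"
  have k: "0 < k" "k * (u - l) = 1" using lu by (auto simp: k_def)
  let ?F = "\<lambda>y. k * ((y - l)^2 * b - (u - y)^2 * a) / 2"
  have "(\<integral>\<^sup>+y. ennreal (((u - y) * a + (y - l) * b) / (u - l)) * indicator {l..u} y \<partial>lborel)
      = (\<integral>\<^sup>+y. ennreal (k * ((u - y) * a + (y - l) * b)) * indicator {l..u} y \<partial>lborel)"
    by (simp add: k_def)
  also have "\<dots> = ennreal (?F u - ?F l)"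
  proof (rule nn_integral_FTC_Icc)
    show "DERIV ?F y :> k * ((u - y) * a + (y - l) * b)" for y
      by (auto intro!: derivative_eq_intros simp: field_simps)
    show "0 \<le> k * ((u - y) * a + (y - l) * b)" if "y \<in> {l..u}" for y
      using that k(1) ab by auto
  qed (use lu in auto)
  also have "?F u - ?F l = (k * (u - l)) * ((u - l) / 2 * (a + b))"
    by (simp add: field_simps power2_eq_square)
  also have "\<dots> = (u - l) / 2 * (a + b)" by (simp add: k(2))
  finally show ?thesis .
qed

text \<open>Push a point \<open>x\<close> through a fixed centre \<open>z\<close> into a small ball around it: a very negative value at
  \<open>x\<close> would force a large value at the opposite point of the ball, where the function is bounded.\<close>

lemma convex_on_bounded_below:
  fixes f :: "'a::euclidean_space \<Rightarrow> real"
  assumes "open S" "bounded S" "convex_on S f"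
  obtains m where "\<And>x. x \<in> S \<Longrightarrow> m \<le> f x"
proof (cases "S = {}")
  case False
  then obtain z where z: "z \<in> S" by blast
  then obtain e where e: "0 < e" "cball z e \<subseteq> S" using assms(1) by (auto simp: open_contains_cball)
  have "continuous_on (cball z e) f"
    using convex_on_continuous[OF assms(1,3)] e(2) by (rule continuous_on_subset)
  then have "bdd_above (f ` cball z e)"
    by (intro bounded_imp_bdd_above compact_imp_bounded compact_continuous_image) auto
  then obtain M where M: "\<forall>y\<in>cball z e. f y \<le> M"
    by (auto simp: bdd_above_def)
  obtain D where D: "0 < D" "\<And>x. x \<in> S \<Longrightarrow> dist z x \<le> D"
  proof -
    obtain D where "\<forall>x\<in>S. dist z x \<le> D" using assms(2) by (auto simp: bounded_any_center[of S z])
    then show ?thesis by (intro that[of "max 1 D"]) (auto intro: order_trans)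
  qed
  \<comment> \<open>With this ratio the point opposite to \<open>x\<close> stays within distance \<open>e\<close> of the centre.\<close>
  define s where "s = e / D"
  have s: "0 < s" using e(1) D(1) by (simp add: s_def)
  show ?thesis
  proof (rule that)
    fix x assume x: "x \<in> S"
    define y where "y = z - s *\<^sub>R (x - z)"
    have "dist z y = s * dist z x" using s by (simp add: y_def dist_norm norm_minus_commute)
    also have "\<dots> \<le> s * D" using D(2)[OF x] s by simp
    also have "\<dots> = e" using D(1) by (simp add: s_def)
    finally have y: "y \<in> cball z e" by simp
    define u where "u = s / (1 + s)"
    have u: "0 \<le> u" "u \<le> 1" "1 - u = 1 / (1 + s)" using s by (auto simp: u_def field_simps)
    have "(1 - u) *\<^sub>R y + u *\<^sub>R x = (1 / (1 + s)) *\<^sub>R (y + s *\<^sub>R x)"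
      unfolding u(3) by (simp add: u_def scaleR_add_right)
    also have "y + s *\<^sub>R x = (1 + s) *\<^sub>R z" by (simp add: y_def algebra_simps)
    finally have "(1 - u) *\<^sub>R y + u *\<^sub>R x = z" using s by simp
    then have "f z \<le> (1 - u) * f y + u * f x"
      using convex_onD[OF assms(3) u(1,2), of y x] y e(2) x by auto
    also have "\<dots> \<le> (1 - u) * M + u * f x" using bspec[OF M y] u(2) by (simp add: mult_left_mono)
    also have "\<dots> = (M + s * f x) / (1 + s)" unfolding u(3) by (simp add: u_def add_divide_distrib)
    finally have "(1 + s) * f z \<le> M + s * f x" using s by (simp add: pos_le_divide_eq mult.commute)
    then show "((1 + s) * f z - M) / s \<le> f x" using s by (simp add: field_simps)
  qed
qed (use that in auto)

lemma hausdorff_outer_segment_le: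
  assumes "a \<le> b"
  shows "hausdorff_outer 1 (plane_point i c ` {a..b}) \<le> ennreal (b - a)"
  by (rule order_trans[OF hausdorff_outer_lipschitz hausdorff_outer_interval_le[OF assms]])
     (simp add: dist_plane_point)

section \<open>Chords of a planar convex domain\<close>

locale planar_convex_domain =
  fixes \<Omega> :: "(real ^ 2) set"
  assumes open_dom: "open \<Omega>" and ne_dom: "\<Omega> \<noteq> {}" and bounded_dom: "bounded \<Omega>" and convex_dom: "convex \<Omega>"
begin

definition shadow :: "2 \<Rightarrow> real set" where "shadow i = (\<lambda>p. p $ i) ` \<Omega>"
definition left :: "2 \<Rightarrow> real" where "left i = Inf (shadow i)"
definition right :: "2 \<Rightarrow> real" where "right i = Sup (shadow i)"
definition slice :: "2 \<Rightarrow> real \<Rightarrow> real set" where "slice i t = {y. plane_point i t y \<in> \<Omega>}"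
text \<open>The slice over \<open>t\<close> is the open interval from \<open>lower i t\<close> to \<open>upper i t\<close>. The value \<open>0\<close> outside the
  shadow makes both ends Borel functions on the whole line.\<close>

definition lower :: "2 \<Rightarrow> real \<Rightarrow> real" where "lower i t = (if t \<in> shadow i then Inf (slice i t) else 0)"
definition upper :: "2 \<Rightarrow> real \<Rightarrow> real" where "upper i t = (if t \<in> shadow i then Sup (slice i t) else 0)"

lemma shadow_iff: "t \<in> shadow i \<longleftrightarrow> slice i t \<noteq> {}"
proof
  assume "t \<in> shadow i"
  then obtain p where p: "p \<in> \<Omega>" "t = p $ i" by (auto simp: shadow_def)
  obtain j where "i \<noteq> j" using exhaust_2 by (metis one_neq_zero zero_neq_one)
  then have "p $ j \<in> slice i t" using p by (simp add: slice_def plane_point_eta)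
  then show "slice i t \<noteq> {}" by blast
next
  assume "slice i t \<noteq> {}"
  then obtain y where "plane_point i t y \<in> \<Omega>" by (auto simp: slice_def)
  then show "t \<in> shadow i" unfolding shadow_def by (intro image_eqI[of _ _ "plane_point i t y"]) auto
qed

lemma open_section: "open {t. plane_point i t y \<in> \<Omega>}"
  using continuous_open_preimage[of UNIV "\<lambda>t. plane_point i t y" \<Omega>] open_dom
  by (simp add: continuous_intros vimage_def)

lemma open_slice: "open (slice i t)"
  using continuous_open_preimage[of UNIV "\<lambda>y. plane_point i t y" \<Omega>] open_dom
  by (simp add: continuous_intros vimage_def slice_def)

lemma open_shadow: "open (shadow i)"
proof -
  have "shadow i = (\<Union>y. {t. plane_point i t y \<in> \<Omega>})"
    by (auto simp: shadow_iff slice_def)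
  then show ?thesis using open_section by (auto intro!: open_UN)
qed

lemma slice_combine:
  assumes "x \<in> slice i s" "y \<in> slice i t" "0 \<le> u" "u \<le> 1"
  shows "(1 - u) * x + u * y \<in> slice i ((1 - u) * s + u * t)"
  using assms convexD_alt[OF convex_dom, of "plane_point i s x" "plane_point i t y" u]
  by (simp add: slice_def plane_point_affine)

lemma convex_slice: "convex (slice i t)"
proof (rule convexI)
  fix x y u v :: real
  assume "x \<in> slice i t" "y \<in> slice i t" "0 \<le> u" "0 \<le> v" "u + v = 1"
  moreover from this have "u = 1 - v" "(1 - v) * t + v * t = t" by (auto simp: algebra_simps)
  ultimately show "u *\<^sub>R x + v *\<^sub>R y \<in> slice i t"
    using slice_combine[of x i t y t v] by simp
qed

lemma convex_shadow: "convex (shadow i)"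
  unfolding shadow_def by (rule convex_linear_image[OF _ convex_dom]) (rule bounded_linear.linear[OF bounded_linear_vec_nth])

lemma bounded_shadow: "bounded (shadow i)"
proof -
  obtain B where B: "\<And>p. p \<in> \<Omega> \<Longrightarrow> norm p \<le> B" using bounded_dom by (auto simp: bounded_iff)
  have "\<bar>p $ i\<bar> \<le> B" if "p \<in> \<Omega>" for p
    using component_le_norm_cart[of p i] B[OF that] by linarith
  then show ?thesis by (auto simp: shadow_def bounded_iff)
qed

lemma bounded_slice: "bounded (slice i t)"
proof -
  obtain B where B: "\<And>p. p \<in> \<Omega> \<Longrightarrow> norm p \<le> B" using bounded_dom by (auto simp: bounded_iff)
  obtain j where j: "j \<noteq> i" using exhaust_2 by (metis one_neq_zero zero_neq_one)
  have "\<bar>y\<bar> \<le> B" if "y \<in> slice i t" for y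
    using component_le_norm_cart[of "plane_point i t y" j] B[of "plane_point i t y"] that j
    by (simp add: slice_def)
  then show ?thesis by (auto simp: bounded_iff)
qed

lemma shadow_eq: "shadow i = {left i<..<right i}"
  unfolding left_def right_def
  using ne_dom by (intro open_convex_real_eq open_shadow convex_shadow bounded_shadow) (auto simp: shadow_def)

lemma left_less_right: "left i < right i"
  using shadow_eq[of i] ne_dom by (auto simp: shadow_def)

lemma slice_eq:
  assumes "t \<in> shadow i"
  shows "slice i t = {lower i t<..<upper i t}"
  using assms open_convex_real_eq[OF open_slice convex_slice bounded_slice, of i t]
  by (simp add: lower_def upper_def shadow_iff)

lemma lower_less_upper: "t \<in> shadow i \<Longrightarrow> lower i t < upper i t"
  using slice_eq[of t i] by (auto simp: shadow_iff)

text \<open>On the shadow the upper end is lower semicontinuous: the domain is open, so \<open>upper i t > c\<close> is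
  witnessed by an interior point above \<open>c\<close>, which persists for nearby \<open>t\<close>.\<close>

lemma borel_measurable_upper [measurable]: "upper i \<in> borel_measurable borel"
  unfolding borel_measurable_iff_greater
proof
  fix c
  have "{t. t \<in> shadow i \<and> c < upper i t} = (\<Union>y\<in>{c<..}. {t. plane_point i t y \<in> \<Omega>})"
  proof (intro set_eqI iffI)
    fix t assume "t \<in> {t. t \<in> shadow i \<and> c < upper i t}"
    then have t: "t \<in> shadow i" "c < upper i t" by auto
    then have "max c (lower i t) < upper i t" using lower_less_upper[OF t(1)] by simp
    then obtain y where "max c (lower i t) < y" "y < upper i t" using dense by blast
    then have "c < y" "y \<in> slice i t" using slice_eq[OF t(1)] by auto
    then show "t \<in> (\<Union>y\<in>{c<..}. {t. plane_point i t y \<in> \<Omega>})" by (auto simp: slice_def)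
  next
    fix t assume "t \<in> (\<Union>y\<in>{c<..}. {t. plane_point i t y \<in> \<Omega>})"
    then obtain y where y: "c < y" "y \<in> slice i t" by (auto simp: slice_def)
    then have "t \<in> shadow i" by (auto simp: shadow_iff)
    with y slice_eq[of t i] show "t \<in> {t. t \<in> shadow i \<and> c < upper i t}" by auto
  qed
  then have "open {t. t \<in> shadow i \<and> c < upper i t}" using open_section by (auto intro!: open_UN)
  moreover have "{t \<in> space borel. c < upper i t}
      = {t. t \<in> shadow i \<and> c < upper i t} \<union> (if c < 0 then - shadow i else {})"
    by (auto simp: upper_def)
  ultimately show "{t \<in> space borel. c < upper i t} \<in> sets borel"
    using open_shadow[of i] by (auto intro!: sets.Un)
qed

lemma borel_measurable_lower [measurable]: "lower i \<in> borel_measurable borel"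
  unfolding borel_measurable_iff_less
proof
  fix c
  have "{t. t \<in> shadow i \<and> lower i t < c} = (\<Union>y\<in>{..<c}. {t. plane_point i t y \<in> \<Omega>})"
  proof (intro set_eqI iffI)
    fix t assume "t \<in> {t. t \<in> shadow i \<and> lower i t < c}"
    then have t: "t \<in> shadow i" "lower i t < c" by auto
    then have "lower i t < min c (upper i t)" using lower_less_upper[OF t(1)] by simp
    then obtain y where "lower i t < y" "y < min c (upper i t)" using dense by blast
    then have "y < c" "y \<in> slice i t" using slice_eq[OF t(1)] by auto
    then show "t \<in> (\<Union>y\<in>{..<c}. {t. plane_point i t y \<in> \<Omega>})" by (auto simp: slice_def)
  next
    fix t assume "t \<in> (\<Union>y\<in>{..<c}. {t. plane_point i t y \<in> \<Omega>})"
    then obtain y where y: "y < c" "y \<in> slice i t" by (auto simp: slice_def)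
    then have "t \<in> shadow i" by (auto simp: shadow_iff)
    with y slice_eq[of t i] show "t \<in> {t. t \<in> shadow i \<and> lower i t < c}" by auto
  qed
  then have "open {t. t \<in> shadow i \<and> lower i t < c}" using open_section by (auto intro!: open_UN)
  moreover have "{t \<in> space borel. lower i t < c}
      = {t. t \<in> shadow i \<and> lower i t < c} \<union> (if 0 < c then - shadow i else {})"
    by (auto simp: lower_def)
  ultimately show "{t \<in> space borel. lower i t < c} \<in> sets borel"
    using open_shadow[of i] by (auto intro!: sets.Un)
qed

lemma plane_point_closure:
  assumes t: "t \<in> shadow i" and y: "lower i t \<le> y" "y \<le> upper i t"
  shows "plane_point i t y \<in> closure \<Omega>"
proof -
  have "plane_point i t ` closure (slice i t) \<subseteq> closure \<Omega>"
    using closure_subset[of \<Omega>]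
    by (intro image_closure_subset continuous_intros closed_closure) (auto simp: slice_def)
  moreover have "y \<in> closure (slice i t)"
    using y lower_less_upper[OF t] by (simp add: slice_eq[OF t] closure_greaterThanLessThan)
  ultimately show ?thesis by blast
qed

lemma plane_point_frontier:
  assumes t: "t \<in> shadow i" and y: "y = lower i t \<or> y = upper i t"
  shows "plane_point i t y \<in> frontier \<Omega>"
proof -
  have "y \<notin> slice i t" using y by (auto simp: slice_eq[OF t])
  moreover have "lower i t \<le> y" "y \<le> upper i t" using y lower_less_upper[OF t] by auto
  ultimately show ?thesis
    using plane_point_closure[OF t] open_dom by (simp add: frontier_def interior_open slice_def)
qed

lemma dom_borel [measurable]: "\<Omega> \<in> sets borel"
  using open_dom by simp

lemma area_finite: "emeasure lborel \<Omega> = ennreal (measure lborel \<Omega>)"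
  using emeasure_bounded_finite[OF bounded_dom] by (simp add: emeasure_eq_ennreal_measure less_top)

lemma area_pos: "0 < measure lborel \<Omega>"
proof -
  obtain p where "p \<in> \<Omega>" using ne_dom by blast
  then obtain e where "0 < e" "ball p e \<subseteq> \<Omega>" using open_dom by (auto simp: open_contains_ball)
  then have "emeasure lborel (ball p e) \<le> emeasure lborel \<Omega>" by (intro emeasure_mono) auto
  moreover have "0 < emeasure lborel (ball p e)"
    using \<open>0 < e\<close> by (simp add: emeasure_ball unit_ball_vol_2)
  ultimately show ?thesis by (auto simp: area_finite zero_less_measure_iff)
qed

text \<open>Contracting the chord over \<open>t\<^sub>0\<close> by the factor \<open>1/2\<close> towards the points of the domain yields
  segments of half its length inside the domain, and these lie over an interval of half the width
  of the shadow.\<close>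

lemma slice_length_le:
  assumes t0: "t\<^sub>0 \<in> shadow i"
  shows "(upper i t\<^sub>0 - lower i t\<^sub>0) * (right i - left i) \<le> 4 * measure lborel \<Omega>"
proof -
  define a b where "a = (left i + t\<^sub>0) / 2" and "b = (right i + t\<^sub>0) / 2"
  define d where "d = (upper i t\<^sub>0 - lower i t\<^sub>0) / 2"
  have d0: "0 \<le> d" using lower_less_upper[OF t0] by (simp add: d_def)
  have half: "ennreal d \<le> emeasure lborel (slice i t)" if t: "t \<in> {a<..<b}" for t
  proof -
    have "2 * t - t\<^sub>0 \<in> shadow i" using t by (auto simp: shadow_eq a_def b_def)
    then obtain z where z: "z \<in> slice i (2 * t - t\<^sub>0)" by (auto simp: shadow_iff)
    \<comment> \<open>Midpoints of a fixed point over \<open>2 t - t\<^sub>0\<close> and the points of the chord over \<open>t\<^sub>0\<close> lie over \<open>t\<close>.\<close>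
    have "{(z + lower i t\<^sub>0) / 2<..<(z + upper i t\<^sub>0) / 2} \<subseteq> slice i t"
    proof
      fix y assume "y \<in> {(z + lower i t\<^sub>0) / 2<..<(z + upper i t\<^sub>0) / 2}"
      then have "2 * y - z \<in> slice i t\<^sub>0" by (auto simp: slice_eq[OF t0])
      then show "y \<in> slice i t" using slice_combine[OF z, of "2 * y - z" t\<^sub>0 "1/2"]
        by (simp add: diff_divide_distrib)
    qed
    then have "emeasure lborel {(z + lower i t\<^sub>0) / 2<..<(z + upper i t\<^sub>0) / 2} \<le> emeasure lborel (slice i t)"
      using open_slice by (intro emeasure_mono) auto
    moreover have "emeasure lborel {(z + lower i t\<^sub>0) / 2<..<(z + upper i t\<^sub>0) / 2} = ennreal d"
      using lower_less_upper[OF t0] by (simp add: d_def diff_divide_distrib[symmetric])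
    ultimately show ?thesis by simp
  qed
  have "ennreal (d * (b - a)) = (\<integral>\<^sup>+t. ennreal d * indicator {a<..<b} t \<partial>lborel)"
    using left_less_right[of i] d0
    by (simp add: nn_integral_cmult ennreal_mult a_def b_def divide_right_mono)
  also have "\<dots> \<le> (\<integral>\<^sup>+t. emeasure lborel (slice i t) \<partial>lborel)"
    using half by (intro nn_integral_mono) (auto split: split_indicator)
  also have "\<dots> = (\<integral>\<^sup>+t. \<integral>\<^sup>+y. indicator \<Omega> (plane_point i t y) \<partial>lborel \<partial>lborel)"
  proof (rule nn_integral_cong)
    fix t
    have "emeasure lborel (slice i t) = (\<integral>\<^sup>+y. indicator (slice i t) y \<partial>lborel)"
      using open_slice by simp
    also have "\<dots> = (\<integral>\<^sup>+y. indicator \<Omega> (plane_point i t y) \<partial>lborel)"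
      by (intro nn_integral_cong) (simp add: slice_def indicator_def)
    finally show "emeasure lborel (slice i t) = (\<integral>\<^sup>+y. indicator \<Omega> (plane_point i t y) \<partial>lborel)" .
  qed
  also have "\<dots> = (\<integral>\<^sup>+p. indicator \<Omega> p \<partial>lborel)" by (rule nn_integral_plane[symmetric]) simp
  also have "\<dots> = ennreal (measure lborel \<Omega>)" by (simp add: area_finite)
  finally have "d * (b - a) \<le> measure lborel \<Omega>" by (simp add: ennreal_le_iff)
  moreover have "4 * (d * (b - a)) = (upper i t\<^sub>0 - lower i t\<^sub>0) * (right i - left i)"
    by (simp add: d_def a_def b_def field_simps)
  ultimately show ?thesis by linarith
qed

section \<open>The perimeter\<close>

lemma dom_subset_box: "closure \<Omega> \<subseteq> cbox (\<chi> k. left k) (\<chi> k. right k)"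
proof (rule closure_minimal)
  show "\<Omega> \<subseteq> cbox (\<chi> k. left k) (\<chi> k. right k)"
  proof
    fix p assume "p \<in> \<Omega>"
    then have "p $ k \<in> shadow k" for k by (auto simp: shadow_def)
    then show "p \<in> cbox (\<chi> k. left k) (\<chi> k. right k)"
      by (auto simp: mem_box_cart shadow_eq less_imp_le)
  qed
qed (rule closed_cbox)

text \<open>The outer normal ray of a supporting line at a boundary point \<open>x\<close> leaves the box, and all its
  points have \<open>x\<close> as their nearest point in the domain.\<close>

lemma frontier_subset_projection:
  "frontier \<Omega> \<subseteq> closest_point (closure \<Omega>) ` frontier (cbox (\<chi> k. left k) (\<chi> k. right k))"
    (is "_ \<subseteq> _ ` frontier ?B")
proof
  fix x assume x: "x \<in> frontier \<Omega>"
  then have xc: "x \<in> closure \<Omega>" "x \<notin> rel_interior \<Omega>"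
    using open_dom by (auto simp: frontier_def interior_open rel_interior_open)
  obtain a where a: "a \<noteq> 0" "\<And>y. y \<in> closure \<Omega> \<Longrightarrow> a \<bullet> x \<le> a \<bullet> y"
    using supporting_hyperplane_relative_frontier[OF convex_dom xc] by metis
  define R where "R = (\<lambda>s. x - s *\<^sub>R a) ` {0..}"
  have "connected R" unfolding R_def
    by (intro connected_continuous_image continuous_intros) (simp add: connected_Ici)
  moreover have "x \<in> R \<inter> ?B"
    using xc(1) dom_subset_box by (auto simp: R_def intro!: image_eqI[of _ _ 0])
  moreover have "R - ?B \<noteq> {}"
  proof
    assume "R - ?B = {}"
    then have "bounded R" using bounded_cbox bounded_subset by blast
    then obtain M where M: "\<And>z. z \<in> R \<Longrightarrow> norm z \<le> M" by (auto simp: bounded_iff)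
    have "norm x \<le> M" using M[of x] \<open>x \<in> R \<inter> ?B\<close> by blast
    with norm_ge_zero[of x] have "0 \<le> M" by linarith
    define s where "s = (norm x + M + 1) / norm a"
    have "0 \<le> s" using \<open>0 \<le> M\<close> by (simp add: s_def)
    then have "norm (x - s *\<^sub>R a) \<le> M" by (intro M) (auto simp: R_def)
    moreover have "norm (s *\<^sub>R a) = norm x + M + 1"
      using a(1) \<open>0 \<le> M\<close> by (simp add: s_def)
    moreover have "norm (s *\<^sub>R a) \<le> norm (x - s *\<^sub>R a) + norm x"
      using norm_triangle_ineq4[of x "x - s *\<^sub>R a"] by simp
    ultimately show False by linarith
  qed
  ultimately have "R \<inter> frontier ?B \<noteq> {}" by (intro connected_Int_frontier) auto
  then obtain s where s: "0 \<le> s" "x - s *\<^sub>R a \<in> frontier ?B" by (auto simp: R_def)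
  have "x = closest_point (closure \<Omega>) (x - s *\<^sub>R a)"
  proof (rule closest_point_unique)
    show "\<forall>z\<in>closure \<Omega>. dist (x - s *\<^sub>R a) x \<le> dist (x - s *\<^sub>R a) z"
    proof
      fix z assume z: "z \<in> closure \<Omega>"
      have "(norm (s *\<^sub>R a))\<^sup>2 \<le> (norm (s *\<^sub>R a))\<^sup>2 + 2 * (s * (a \<bullet> (z - x))) + (norm (z - x))\<^sup>2"
        using a(2)[OF z] s(1) by (simp add: inner_diff_right)
      also have "\<dots> = (norm (z - (x - s *\<^sub>R a)))\<^sup>2"
        unfolding power2_norm_eq_inner
        by (simp add: inner_diff_left inner_diff_right inner_add_left inner_add_right inner_commute algebra_simps)
      finally have "norm (s *\<^sub>R a) \<le> norm (z - (x - s *\<^sub>R a))"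
        by (rule power2_le_imp_le) simp
      then show "dist (x - s *\<^sub>R a) x \<le> dist (x - s *\<^sub>R a) z"
        by (simp add: dist_norm norm_minus_commute)
    qed
  qed (use xc convex_dom in auto)
  with s(2) show "x \<in> closest_point (closure \<Omega>) ` frontier ?B" by blast
qed

text \<open>Nearest-point projection onto a convex set is a contraction, so the perimeter of the
  bounding box is an upper bound.\<close>

lemma perimeter_le:
  assumes ij: "i \<noteq> j"
  shows "hausdorff_outer 1 (frontier \<Omega>) \<le> ennreal (2 * (right i - left i) + 2 * (right j - left j))"
proof -
  let ?B = "cbox (\<chi> k. left k) (\<chi> k. right k) :: (real ^ 2) set"
  let ?S = "\<lambda>k c l. plane_point k c ` {left l..right l}"
  have "hausdorff_outer 1 (frontier \<Omega>) \<le> hausdorff_outer 1 (closest_point (closure \<Omega>) ` frontier ?B)"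
    by (rule hausdorff_outer_mono[OF frontier_subset_projection])
  also have "\<dots> \<le> hausdorff_outer 1 (frontier ?B)"
    using convex_dom ne_dom by (intro hausdorff_outer_lipschitz closest_point_lipschitz) auto
  also have "\<dots> \<le> hausdorff_outer 1 ((?S i (left i) j \<union> ?S i (right i) j) \<union> (?S j (left j) i \<union> ?S j (right j) i))"
  proof (rule hausdorff_outer_mono, rule subsetI)
    fix p assume "p \<in> frontier ?B"
    then have p: "\<And>k. left k \<le> p $ k" "\<And>k. p $ k \<le> right k"
      "\<not> (left i < p $ i \<and> p $ i < right i \<and> left j < p $ j \<and> p $ j < right j)"
      using all_2_iff[OF ij, of "\<lambda>k. left k < p $ k \<and> p $ k < right k"]
      by (auto simp: frontier_cbox mem_box_cart)
    have 1: "p = plane_point i (p $ i) (p $ j)" "p = plane_point j (p $ j) (p $ i)"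
      using ij by (simp_all add: plane_point_eta)
    have 2: "p $ i \<in> {left i..right i}" "p $ j \<in> {left j..right j}" using p by auto
    consider "p $ i = left i" | "p $ i = right i" | "p $ j = left j" | "p $ j = right j"
      using p(1,2)[of i] p(1,2)[of j] p(3) by fastforce
    then show "p \<in> (?S i (left i) j \<union> ?S i (right i) j) \<union> (?S j (left j) i \<union> ?S j (right j) i)"
    proof cases
      case 1 then show ?thesis using \<open>p = plane_point i (p $ i) (p $ j)\<close> 2 by (metis UnCI imageI)
    next
      case 2 then show ?thesis using 1(1) \<open>p $ j \<in> {left j..right j}\<close> by (metis UnCI imageI)
    next
      case 3 then show ?thesis using 1(2) 2 by (metis UnCI imageI)
    next
      case 4 then show ?thesis using 1(2) 2 by (metis UnCI imageI)
    qed
  qed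
  also have "\<dots> \<le> (ennreal (right j - left j) + ennreal (right j - left j))
      + (ennreal (right i - left i) + ennreal (right i - left i))"
    using left_less_right[of i] left_less_right[of j]
    by (intro order_trans[OF hausdorff_outer_Un_le] add_mono hausdorff_outer_segment_le) auto
  also have "\<dots> = ennreal (2 * (right i - left i) + 2 * (right j - left j))"
    using left_less_right[of i] left_less_right[of j] by (simp flip: ennreal_plus)
  finally show ?thesis .
qed

section \<open>The inequality with constant 8\<close>

lemma slice_integral_le:
  assumes f: "convex_on (closure \<Omega>) f" and nonneg: "\<And>x. x \<in> frontier \<Omega> \<Longrightarrow> 0 \<le> f x"
    and t: "t \<in> shadow i"
  shows "(\<integral>\<^sup>+y. indicator \<Omega> (plane_point i t y) * ennreal (f (plane_point i t y)) \<partial>lborel)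
    \<le> ennreal ((upper i t - lower i t) / 2 * (f (plane_point i t (lower i t)) + f (plane_point i t (upper i t))))"
proof -
  define l u where "l = lower i t" and "u = upper i t"
  define a b where "a = f (plane_point i t l)" and "b = f (plane_point i t u)"
  have lu: "l < u" using lower_less_upper[OF t] by (simp add: l_def u_def)
  have ab: "0 \<le> a" "0 \<le> b"
    using nonneg plane_point_frontier[OF t] by (auto simp: a_def b_def l_def u_def)
  have "(\<integral>\<^sup>+y. indicator \<Omega> (plane_point i t y) * ennreal (f (plane_point i t y)) \<partial>lborel)
      \<le> (\<integral>\<^sup>+y. ennreal (((u - y) * a + (y - l) * b) / (u - l)) * indicator {l..u} y \<partial>lborel)"
  proof (rule nn_integral_mono)
    fix y
    show "indicator \<Omega> (plane_point i t y) * ennreal (f (plane_point i t y))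
      \<le> ennreal (((u - y) * a + (y - l) * b) / (u - l)) * indicator {l..u} y"
    proof (cases "plane_point i t y \<in> \<Omega>")
      case True
      then have y: "l < y" "y < u" using slice_eq[OF t] by (auto simp: slice_def l_def u_def)
      define v where "v = (y - l) / (u - l)"
      have v: "0 \<le> v" "v \<le> 1" using y by (auto simp: v_def)
      have v1: "1 - v = (u - y) / (u - l)" using lu by (simp add: v_def field_simps)
      have "(1 - v) * t + v * t = t" by (simp add: algebra_simps)
      moreover have "(1 - v) * l + v * u = y"
      proof -
        have "v * (u - l) = y - l" using lu by (simp add: v_def)
        then show ?thesis by (simp add: algebra_simps)
      qed
      ultimately have "plane_point i t y = (1 - v) *\<^sub>R plane_point i t l + v *\<^sub>R plane_point i t u"
        using plane_point_affine[of i v t t l u] by simp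
      also have "f \<dots> \<le> (1 - v) * a + v * b"
        unfolding a_def b_def using plane_point_closure[OF t] lu
        by (intro convex_onD[OF f v]) (auto simp: l_def u_def)
      also have "\<dots> = ((u - y) * a + (y - l) * b) / (u - l)"
        unfolding v1 by (simp add: v_def add_divide_distrib)
      finally show ?thesis using y True by (simp add: ennreal_leI)
    qed simp
  qed
  also have "\<dots> = ennreal ((u - l) / 2 * (a + b))" by (rule nn_integral_chord[OF lu ab])
  finally show ?thesis by (simp add: a_def b_def l_def u_def)
qed

lemma convex_fun_borel:
  assumes "convex_on (closure \<Omega>) f"
  shows "(\<lambda>p. indicator \<Omega> p *\<^sub>R f p) \<in> borel_measurable borel"
  using convex_on_subset[OF assms closure_subset convex_dom]
  by (intro borel_measurable_continuous_on_indicator convex_on_continuous open_dom) auto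

text \<open>The lower and the upper ends of the slices trace out two disjoint parts of the boundary, on each
  of which projection to the shadow is injective and does not increase length.\<close>

lemma ends_integral_le:
  assumes h [measurable]: "h \<in> borel_measurable borel"
  shows "(\<integral>\<^sup>+t. indicator (shadow i) t *
      (h (plane_point i t (lower i t)) + h (plane_point i t (upper i t))) \<partial>lborel)
    \<le> (\<integral>\<^sup>+p. h p \<partial>hausdorff_measure 1)"
proof -
  obtain j where j: "j \<noteq> i" using exhaust_2 by (metis one_neq_zero zero_neq_one)
  define L where "L = {p. p $ i \<in> shadow i \<and> p $ j = lower i (p $ i)}"
  define U where "U = {p. p $ i \<in> shadow i \<and> p $ j = upper i (p $ i)}"
  have [measurable]: "shadow i \<in> sets borel" using open_shadow by simp
  have [measurable]: "(\<lambda>p :: real ^ 2. p $ k) \<in> borel_measurable borel" for k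
    by (intro borel_measurable_continuous_onI continuous_intros)
  have [measurable]: "L \<in> sets borel" "U \<in> sets borel"
    unfolding L_def U_def by measurable
  have "(\<integral>\<^sup>+t. indicator (shadow i) t *
      (h (plane_point i t (lower i t)) + h (plane_point i t (upper i t))) \<partial>lborel)
    = (\<integral>\<^sup>+t. indicator (shadow i) t * h (plane_point i t (lower i t)) \<partial>lborel)
      + (\<integral>\<^sup>+t. indicator (shadow i) t * h (plane_point i t (upper i t)) \<partial>lborel)"
    by (simp add: distrib_left nn_integral_add)
  also have "\<dots> \<le> (\<integral>\<^sup>+p. indicator L p * h p \<partial>hausdorff_measure 1)
      + (\<integral>\<^sup>+p. indicator U p * h p \<partial>hausdorff_measure 1)"
    using j by (intro add_mono nn_integral_le_hausdorff_1[where i=i]) (auto simp: L_def U_def)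
  also have "\<dots> = (\<integral>\<^sup>+p. indicator L p * h p + indicator U p * h p \<partial>hausdorff_measure 1)"
    by (rule nn_integral_add[symmetric]) simp_all
  also have "\<dots> \<le> (\<integral>\<^sup>+p. h p \<partial>hausdorff_measure 1)"
  proof (rule nn_integral_mono)
    fix p
    have "p \<notin> L \<or> p \<notin> U" using lower_less_upper[of "p $ i" i] by (auto simp: L_def U_def)
    then show "indicator L p * h p + indicator U p * h p \<le> h p" by (auto simp: indicator_def)
  qed
  finally show ?thesis .
qed

lemma nn_integral_dom_le:
  assumes f: "convex_on (closure \<Omega>) f" and nonneg: "\<And>x. x \<in> frontier \<Omega> \<Longrightarrow> 0 \<le> f x"
    and meas: "(\<lambda>p. indicator (frontier \<Omega>) p *\<^sub>R f p) \<in> borel_measurable borel"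
  shows "(\<integral>\<^sup>+p. ennreal (indicator \<Omega> p *\<^sub>R f p) \<partial>lborel)
    \<le> ennreal (2 * measure lborel \<Omega> / (right i - left i))
      * (\<integral>\<^sup>+p. ennreal (indicator (frontier \<Omega>) p *\<^sub>R f p) \<partial>hausdorff_measure 1)"
proof -
  let ?c = "2 * measure lborel \<Omega> / (right i - left i)"
  define h where "h p = ennreal (indicator (frontier \<Omega>) p *\<^sub>R f p)" for p
  have [measurable]: "h \<in> borel_measurable borel" unfolding h_def using meas by simp
  have [measurable]: "shadow i \<in> sets borel" using open_shadow by simp
  have "(\<integral>\<^sup>+p. ennreal (indicator \<Omega> p *\<^sub>R f p) \<partial>lborel)
      = (\<integral>\<^sup>+t. \<integral>\<^sup>+y. ennreal (indicator \<Omega> (plane_point i t y) *\<^sub>R f (plane_point i t y)) \<partial>lborel \<partial>lborel)"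
    using convex_fun_borel[OF f] by (intro nn_integral_plane) simp
  also have "\<dots> = (\<integral>\<^sup>+t. \<integral>\<^sup>+y. indicator \<Omega> (plane_point i t y) * ennreal (f (plane_point i t y)) \<partial>lborel \<partial>lborel)"
    by (intro nn_integral_cong) (simp add: indicator_def)
  also have "\<dots> \<le> (\<integral>\<^sup>+t. ennreal ?c * (indicator (shadow i) t *
      (h (plane_point i t (lower i t)) + h (plane_point i t (upper i t)))) \<partial>lborel)"
  proof (rule nn_integral_mono)
    fix t
    show "(\<integral>\<^sup>+y. indicator \<Omega> (plane_point i t y) * ennreal (f (plane_point i t y)) \<partial>lborel)
      \<le> ennreal ?c * (indicator (shadow i) t *
        (h (plane_point i t (lower i t)) + h (plane_point i t (upper i t))))"
    proof (cases "t \<in> shadow i")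
      case False
      then have "plane_point i t y \<notin> \<Omega>" for y by (auto simp: shadow_iff slice_def)
      then show ?thesis by simp
    next
      case True
      let ?a = "f (plane_point i t (lower i t))" and ?b = "f (plane_point i t (upper i t))"
      have fr: "plane_point i t (lower i t) \<in> frontier \<Omega>" "plane_point i t (upper i t) \<in> frontier \<Omega>"
        using plane_point_frontier[OF True] by auto
      then have ab: "0 \<le> ?a" "0 \<le> ?b" using nonneg by auto
      have "(upper i t - lower i t) / 2 \<le> ?c"
        using slice_length_le[OF True] left_less_right[of i] by (simp add: field_simps)
      then have "(upper i t - lower i t) / 2 * (?a + ?b) \<le> ?c * (?a + ?b)"
        using ab by (intro mult_right_mono) auto
      then have "ennreal ((upper i t - lower i t) / 2 * (?a + ?b)) \<le> ennreal (?c * (?a + ?b))"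
        by (rule ennreal_leI)
      also have "\<dots> = ennreal ?c * (ennreal ?a + ennreal ?b)"
        using left_less_right[of i]
        by (subst ennreal_mult) (auto simp: ennreal_plus[OF ab] intro: ab add_nonneg_nonneg)
      finally show ?thesis
        using slice_integral_le[OF f nonneg True] True fr by (simp add: h_def)
    qed
  qed
  also have "\<dots> = ennreal ?c * (\<integral>\<^sup>+t. indicator (shadow i) t *
      (h (plane_point i t (lower i t)) + h (plane_point i t (upper i t))) \<partial>lborel)"
    by (rule nn_integral_cmult) measurable
  also have "\<dots> \<le> ennreal ?c * (\<integral>\<^sup>+p. h p \<partial>hausdorff_measure 1)"
    by (intro mult_left_mono ends_integral_le) auto
  finally show ?thesis by (simp add: h_def)
qed

lemma frontier_borel [measurable]: "frontier \<Omega> \<in> sets borel"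
  by simp

lemma perimeter_bounds:
  shows perimeter_ge: "right i - left i \<le> measure (hausdorff_measure 1) (frontier \<Omega>)"
    and perimeter_finite: "emeasure (hausdorff_measure 1) (frontier \<Omega>) \<noteq> \<infinity>"
    and perimeter_upper: "i \<noteq> j \<Longrightarrow> measure (hausdorff_measure 1) (frontier \<Omega>)
      \<le> 2 * (right i - left i) + 2 * (right j - left j)"
proof -
  have up: "emeasure (hausdorff_measure 1) (frontier \<Omega>)
      \<le> ennreal (2 * (right i - left i) + 2 * (right j - left j))" if "i \<noteq> j" for i j
    using perimeter_le[OF that] by (simp add: emeasure_hausdorff_measure)
  have "emeasure (hausdorff_measure 1) (frontier \<Omega>) < \<infinity>"
    using up[of 1 2] by (simp add: le_less_trans)
  then show fin: "emeasure (hausdorff_measure 1) (frontier \<Omega>) \<noteq> \<infinity>" by simp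
  then have eq: "emeasure (hausdorff_measure 1) (frontier \<Omega>) = ennreal (measure (hausdorff_measure 1) (frontier \<Omega>))"
    by (simp add: emeasure_eq_ennreal_measure)
  show "measure (hausdorff_measure 1) (frontier \<Omega>)
      \<le> 2 * (right i - left i) + 2 * (right j - left j)" if "i \<noteq> j"
    by (rule ennreal_le_iff[THEN iffD1, OF _ up[OF that, unfolded eq]])
       (use left_less_right[of i] left_less_right[of j] in auto)
  have "emeasure lborel (shadow i) \<le> emeasure (hausdorff_measure 1) (frontier \<Omega>)"
  proof (rule emeasure_le_hausdorff_1)
    show "shadow i \<subseteq> (\<lambda>p. p $ i) ` frontier \<Omega>"
    proof
      fix t assume "t \<in> shadow i"
      then show "t \<in> (\<lambda>p. p $ i) ` frontier \<Omega>"
        using plane_point_frontier[of t i "upper i t"]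
        by (intro image_eqI[of _ _ "plane_point i t (upper i t)"]) auto
    qed
  qed (use open_shadow in auto)
  then show "right i - left i \<le> measure (hausdorff_measure 1) (frontier \<Omega>)"
    using left_less_right[of i] unfolding eq shadow_eq by simp
qed

text \<open>The truncation \<open>ennreal (f p)\<close> discards negative values of \<open>f\<close> in the interior. This is harmless for
  the upper bound, and integrability of the negative part follows from the lower bound on \<open>f\<close>.\<close>

lemma hermite_hadamard_8:
  assumes f: "convex_on (closure \<Omega>) f" and nonneg: "\<And>x. x \<in> frontier \<Omega> \<Longrightarrow> 0 \<le> f x"
    and int: "set_integrable (hausdorff_measure 1) (frontier \<Omega>) f"
  shows "set_integrable (hausdorff_measure 2) \<Omega> f"
    and "1 / measure (hausdorff_measure 2) \<Omega> * (LINT x:\<Omega>|hausdorff_measure 2. f x)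
      \<le> 8 / measure (hausdorff_measure 1) (frontier \<Omega>) * (LINT x:frontier \<Omega>|hausdorff_measure 1. f x)"
proof -
  let ?A = "measure lborel \<Omega>" and ?P = "measure (hausdorff_measure 1) (frontier \<Omega>)"
  obtain i j :: 2 where ij: "i \<noteq> j" and wide: "right j - left j \<le> right i - left i"
  proof (cases "right 2 - left 2 \<le> right 1 - left 1")
    case True then show ?thesis by (intro that[of 1 2]) auto
  next
    case False then show ?thesis by (intro that[of 2 1]) auto
  qed
  define w where "w = right i - left i"
  have w: "0 < w" "w \<le> ?P" "?P \<le> 4 * w"
    using left_less_right[of i] perimeter_ge[of i] perimeter_upper[OF ij] wide by (auto simp: w_def)
  let ?fd = "\<lambda>p. indicator \<Omega> p *\<^sub>R f p" and ?fb = "\<lambda>p. indicator (frontier \<Omega>) p *\<^sub>R f p"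
  have fd: "?fd \<in> borel_measurable borel" by (rule convex_fun_borel[OF f])
  then have [measurable]: "(\<lambda>p. indicat_real \<Omega> p * f p) \<in> borel_measurable borel" by simp
  have intb: "integrable (hausdorff_measure 1) ?fb" using int by (simp add: set_integrable_def)
  have fb_nonneg: "0 \<le> ?fb p" for p using nonneg by (auto simp: indicator_def)
  define J where "J = integral\<^sup>L (hausdorff_measure 1) ?fb"
  have J: "0 \<le> J" unfolding J_def using fb_nonneg by simp
  have "(\<integral>\<^sup>+p. ennreal (?fd p) \<partial>lborel)
      \<le> ennreal (2 * ?A / w) * (\<integral>\<^sup>+p. ennreal (?fb p) \<partial>hausdorff_measure 1)"
    unfolding w_def using borel_measurable_integrable[OF intb]
    by (intro nn_integral_dom_le[OF f nonneg]) auto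
  also have "(\<integral>\<^sup>+p. ennreal (?fb p) \<partial>hausdorff_measure 1) = ennreal J"
    unfolding J_def using intb fb_nonneg by (intro nn_integral_eq_integral) auto
  also have "ennreal (2 * ?A / w) * ennreal J = ennreal (2 * ?A / w * J)"
    using w J by (intro ennreal_mult[symmetric]) auto
  finally have nn: "(\<integral>\<^sup>+p. ennreal (?fd p) \<partial>lborel) \<le> ennreal (2 * ?A / w * J)" .
  have intd: "integrable lborel ?fd"
  proof (rule integrableI_bounded)
    obtain m where m: "\<And>x. x \<in> \<Omega> \<Longrightarrow> m \<le> f x"
      using convex_on_bounded_below[OF open_dom bounded_dom convex_on_subset[OF f closure_subset convex_dom]]
      by blast
    have "(\<integral>\<^sup>+p. ennreal (norm (?fd p)) \<partial>lborel)
        \<le> (\<integral>\<^sup>+p. ennreal (?fd p) + ennreal \<bar>m\<bar> * indicator \<Omega> p \<partial>lborel)"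
    proof (rule nn_integral_mono)
      fix p
      show "ennreal (norm (?fd p)) \<le> ennreal (?fd p) + ennreal \<bar>m\<bar> * indicator \<Omega> p"
      proof (cases "p \<in> \<Omega>")
        case True
        show ?thesis
        proof (cases "0 \<le> f p")
          case False
          then have "\<bar>f p\<bar> \<le> \<bar>m\<bar>" using m[OF True] by linarith
          then show ?thesis using True False by (simp add: ennreal_neg ennreal_leI)
        qed (use True in auto)
      qed simp
    qed
    also have "\<dots> = (\<integral>\<^sup>+p. ennreal (?fd p) \<partial>lborel) + ennreal \<bar>m\<bar> * emeasure lborel \<Omega>"
      by (subst nn_integral_add) (auto simp: nn_integral_cmult_indicator)
    also have "\<dots> < \<infinity>"
      using nn by (auto simp: area_finite ennreal_mult_less_top le_less_trans)
    finally show "(\<integral>\<^sup>+p. ennreal (norm (?fd p)) \<partial>lborel) < \<infinity>" .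
  qed (use fd in simp)
  have bound: "integral\<^sup>L lborel ?fd \<le> 2 * ?A / w * J"
    using w J by (intro integral_real_bounded nn) auto
  obtain \<kappa> where \<kappa>: "0 < \<kappa>" "(hausdorff_measure 2 :: (real ^ 2) measure) = density lborel (\<lambda>_. ennreal \<kappa>)"
    by (rule hausdorff_measure_2_eq)
  show "set_integrable (hausdorff_measure 2) \<Omega> f"
    unfolding set_integrable_def \<kappa>(2)
    by (subst integrable_density) (use \<kappa>(1) intd fd in auto)
  have LI: "(LINT x:\<Omega>|hausdorff_measure 2. f x) = \<kappa> * integral\<^sup>L lborel ?fd"
    unfolding set_lebesgue_integral_def \<kappa>(2)
    by (subst integral_density) (use \<kappa>(1) fd in auto)
  have mA: "measure (hausdorff_measure 2) \<Omega> = \<kappa> * ?A"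
    using \<kappa>(1) by (simp add: \<kappa>(2) measure_def emeasure_density_const enn2real_mult)
  have "1 / measure (hausdorff_measure 2) \<Omega> * (LINT x:\<Omega>|hausdorff_measure 2. f x)
      = integral\<^sup>L lborel ?fd / ?A"
    using \<kappa>(1) by (simp add: LI mA)
  also have "\<dots> \<le> (2 * ?A / w * J) / ?A" using bound area_pos by (intro divide_right_mono) auto
  also have "\<dots> = 2 / w * J" using area_pos by simp
  also have "\<dots> \<le> 8 / ?P * J" using w by (intro mult_right_mono J) (auto simp: field_simps)
  finally show "1 / measure (hausdorff_measure 2) \<Omega> * (LINT x:\<Omega>|hausdorff_measure 2. f x)
      \<le> 8 / ?P * (LINT x:frontier \<Omega>|hausdorff_measure 1. f x)"
    by (simp add: J_def set_lebesgue_integral_def)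
qed

end

lemma hermite_hadamard_constant_8: "hermite_hadamard_constant 8"
  unfolding hermite_hadamard_constant_def
proof (intro allI impI, elim conjE)
  fix \<Omega> :: "(real ^ 2) set" and f
  assume "open \<Omega>" "\<Omega> \<noteq> {}" "bounded \<Omega>" "convex \<Omega>"
  then interpret planar_convex_domain \<Omega> by unfold_locales
  assume "convex_on (closure \<Omega>) f" "\<forall>x\<in>frontier \<Omega>. 0 \<le> f x"
    "set_integrable (hausdorff_measure 1) (frontier \<Omega>) f"
  then show "set_integrable (hausdorff_measure 2) \<Omega> f \<and>
      1 / measure (hausdorff_measure 2) \<Omega> * (LINT x:\<Omega>|hausdorff_measure 2. f x)
        \<le> 8 / measure (hausdorff_measure 1) (frontier \<Omega>) * (LINT x:frontier \<Omega>|hausdorff_measure 1. f x)"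
    using hermite_hadamard_8 by blast
qed

section \<open>A thin triangle\<close>

text \<open>The reflection in the centre \<open>c / 2\<close> preserves the set and the measure and exchanges \<open>p $ i\<close> with
  \<open>c $ i - p $ i\<close>. For a segment, this gives the mean of a coordinate without computing the length.\<close>

lemma centrally_symmetric_integral:
  fixes S :: "(real ^ 2) set"
  assumes S: "S \<in> sets borel" "bounded S" "emeasure (hausdorff_measure 1) S < \<infinity>"
    and sym: "\<And>p. p \<in> S \<Longrightarrow> c - p \<in> S"
  shows "integrable (hausdorff_measure 1) (\<lambda>p. indicat_real S p * p $ i)"
    and "(LINT p|hausdorff_measure 1. indicat_real S p * p $ i) = c $ i / 2 * measure (hausdorff_measure 1) S"
proof -
  have [measurable]: "(\<lambda>p :: real ^ 2. p $ i) \<in> borel_measurable borel"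
    by (intro borel_measurable_continuous_onI continuous_intros)
  note [measurable] = S(1)
  obtain B where B: "\<And>p. p \<in> S \<Longrightarrow> norm p \<le> B" using S(2) by (auto simp: bounded_iff)
  have intS: "integrable (hausdorff_measure 1) (indicat_real S)"
    using S by (simp add: integrable_indicator_iff)
  show int: "integrable (hausdorff_measure 1) (\<lambda>p. indicat_real S p * p $ i)"
  proof (rule Bochner_Integration.integrable_bound)
    show "integrable (hausdorff_measure 1) (\<lambda>p. B * indicat_real S p)" using intS by simp
    have "\<bar>p $ i\<bar> \<le> \<bar>B\<bar>" if "p \<in> S" for p
      using component_le_norm_cart[of p i] B[OF that] by linarith
    then show "AE p in hausdorff_measure 1. norm (indicat_real S p * p $ i) \<le> norm (B * indicat_real S p)"
      by (intro AE_I2) (auto simp: indicator_def)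
  qed measurable
  have S_iff: "c - p \<in> S \<longleftrightarrow> p \<in> S" for p
    using sym[of p] sym[of "c - p"] by auto
  have "(LINT p|hausdorff_measure 1. indicat_real S p * p $ i)
      = (LINT p|distr (hausdorff_measure 1) borel (\<lambda>p. c - p). indicat_real S p * p $ i)"
    by (simp only: hausdorff_measure_reflect)
  also have "\<dots> = (LINT p|hausdorff_measure 1. indicat_real S (c - p) * (c - p) $ i)"
    by (rule integral_distr) measurable
  also have "\<dots> = (LINT p|hausdorff_measure 1. c $ i * indicat_real S p - indicat_real S p * p $ i)"
    by (intro Bochner_Integration.integral_cong refl) (auto simp: indicator_def S_iff)
  also have "\<dots> = c $ i * measure (hausdorff_measure 1) S
      - (LINT p|hausdorff_measure 1. indicat_real S p * p $ i)"
    using intS int by (subst Bochner_Integration.integral_diff) simp_all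
  finally show "(LINT p|hausdorff_measure 1. indicat_real S p * p $ i)
      = c $ i / 2 * measure (hausdorff_measure 1) S" by simp
qed

lemma convex_combination_less:
  fixes a b c u :: real
  assumes "a < c" "b \<le> c" "0 \<le> u" "u < 1"
  shows "(1 - u) * a + u * b < c"
proof -
  have "(1 - u) * a < (1 - u) * c" "u * b \<le> u * c"
    using assms by (simp_all add: mult_left_mono)
  moreover have "(1 - u) * c + u * c = c" by (simp add: algebra_simps)
  ultimately show ?thesis by linarith
qed

text \<open>The triangle with vertices \<open>(0, 0)\<close>, \<open>(1, 0)\<close> and \<open>(1, 1/100)\<close>. Thinness makes the short side
  negligible in the perimeter.\<close>

definition thin_triangle :: "(real ^ 2) set" where
  "thin_triangle = {p. 0 < p $ 2 \<and> p $ 2 < p $ 1 / 100 \<and> p $ 1 < 1}"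

lemma coordinate_borel [measurable]: "(\<lambda>p :: real ^ 2. p $ k) \<in> borel_measurable borel"
  by (intro borel_measurable_continuous_onI continuous_intros)

lemma thin_triangle_combination:
  assumes q: "q \<in> thin_triangle" and p: "0 \<le> p $ 2" "p $ 2 \<le> p $ 1 / 100" "p $ 1 \<le> 1"
    and u: "0 \<le> u" "u < 1"
  shows "(1 - u) *\<^sub>R q + u *\<^sub>R p \<in> thin_triangle"
  using convex_combination_less[of "- (q $ 2)" 0 "- (p $ 2)" u]
    convex_combination_less[of "100 * q $ 2 - q $ 1" 0 "100 * p $ 2 - p $ 1" u]
    convex_combination_less[of "q $ 1" 1 "p $ 1" u] q p u
  by (simp add: thin_triangle_def algebra_simps)

lemma thin_triangle_bounded: "bounded thin_triangle"
proof -
  have "norm p \<le> 2" if "p \<in> thin_triangle" for p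
    using norm_le_l1_cart[of p] that by (simp add: thin_triangle_def sum_2)
  then show ?thesis by (auto simp: bounded_iff)
qed

interpretation thin: planar_convex_domain thin_triangle
proof
  show "open thin_triangle" unfolding thin_triangle_def
    by (intro open_Collect_conj open_Collect_less continuous_intros) auto
  show "thin_triangle \<noteq> {}"
  proof -
    have "plane_point 1 (1/2) (1/400) \<in> thin_triangle" by (simp add: thin_triangle_def)
    then show ?thesis by blast
  qed
  show "convex thin_triangle"
    unfolding convex_alt
  proof (intro ballI allI impI, elim conjE)
    fix x y u assume xy: "x \<in> thin_triangle" "y \<in> thin_triangle" and u: "0 \<le> u" "u \<le> (1::real)"
    show "(1 - u) *\<^sub>R x + u *\<^sub>R y \<in> thin_triangle"
    proof (cases "u = 1")
      case False
      then show ?thesis using xy u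
        by (intro thin_triangle_combination) (auto simp: thin_triangle_def)
    qed (use xy in auto)
  qed
qed (rule thin_triangle_bounded)

lemma closure_thin_triangle:
  "closure thin_triangle = {p. 0 \<le> p $ 2 \<and> p $ 2 \<le> p $ 1 / 100 \<and> p $ 1 \<le> 1}" (is "_ = ?C")
proof
  show "closure thin_triangle \<subseteq> ?C"
  proof (rule closure_minimal)
    show "closed ?C" by (intro closed_Collect_conj closed_Collect_le continuous_intros) auto
  qed (auto simp: thin_triangle_def)
  show "?C \<subseteq> closure thin_triangle"
  proof
    fix p assume p: "p \<in> ?C"
    define q where "q = plane_point 1 (1/2) (1/400)"
    have q: "q \<in> thin_triangle" by (simp add: q_def thin_triangle_def)
    show "p \<in> closure thin_triangle"
    proof (cases "p = q")
      case True then show ?thesis using q closure_subset by blast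
    next
      case False
      have "open_segment q p \<subseteq> thin_triangle"
        using thin_triangle_combination[OF q] p by (auto simp: in_segment)
      then have "closure (open_segment q p) \<subseteq> closure thin_triangle" by (rule closure_mono)
      then show ?thesis using False by (auto simp: closure_open_segment)
    qed
  qed
qed

text \<open>The slice over \<open>t\<close> has length \<open>t / 100\<close>, which is the second factor in the derivative of \<open>G\<close>.\<close>

lemma thin_triangle_integral:
  fixes g :: "real \<Rightarrow> real"
  assumes [measurable]: "g \<in> borel_measurable borel" and g: "\<And>t. 0 \<le> t \<Longrightarrow> 0 \<le> g t"
    and G: "\<And>t. DERIV G t :> g t * (t / 100)"
  shows "(\<integral>\<^sup>+p. ennreal (indicat_real thin_triangle p * g (p $ 1)) \<partial>lborel) = ennreal (G 1 - G 0)"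
proof -
  have "(\<integral>\<^sup>+p. ennreal (indicat_real thin_triangle p * g (p $ 1)) \<partial>lborel)
      = (\<integral>\<^sup>+t. \<integral>\<^sup>+y. ennreal (indicat_real thin_triangle (plane_point 1 t y) * g t) \<partial>lborel \<partial>lborel)"
    by (subst nn_integral_plane[of _ 1]) simp_all
  also have "\<dots> = (\<integral>\<^sup>+t. ennreal (g t * (t / 100)) * indicator {0..1} t \<partial>lborel)"
  proof (rule nn_integral_cong_AE)
    have "AE t in lborel. t \<noteq> (1::real)" by (rule AE_lborel_singleton)
    then show "AE t in lborel. (\<integral>\<^sup>+y. ennreal (indicat_real thin_triangle (plane_point 1 t y) * g t) \<partial>lborel)
        = ennreal (g t * (t / 100)) * indicator {0..1} t"
    proof eventually_elim
      fix t :: real assume t1: "t \<noteq> 1"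
      show "(\<integral>\<^sup>+y. ennreal (indicat_real thin_triangle (plane_point 1 t y) * g t) \<partial>lborel)
        = ennreal (g t * (t / 100)) * indicator {0..1} t"
      proof (cases "t \<in> {0..1}")
        case False
        then have "plane_point 1 t y \<notin> thin_triangle" for y by (auto simp: thin_triangle_def)
        then show ?thesis using False by simp
      next
        case True
        have "(\<integral>\<^sup>+y. ennreal (indicat_real thin_triangle (plane_point 1 t y) * g t) \<partial>lborel)
            = (\<integral>\<^sup>+y. ennreal (g t) * indicator {0<..<t / 100} y \<partial>lborel)"
          using True t1 by (intro nn_integral_cong) (auto simp: thin_triangle_def indicator_def)
        also have "\<dots> = ennreal (g t) * ennreal (t / 100)"
          using True by (subst nn_integral_cmult_indicator) auto
        also have "\<dots> = ennreal (g t * (t / 100))"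
          using True g[of t] by (intro ennreal_mult[symmetric]) auto
        finally show ?thesis using True by simp
      qed
    qed
  qed
  also have "\<dots> = ennreal (G 1 - G 0)"
    by (rule nn_integral_FTC_Icc) (use G g in auto)
  finally show ?thesis .
qed

lemma thin_triangle_area: "measure lborel thin_triangle = 1 / 200"
proof -
  have "(\<integral>\<^sup>+p. ennreal (indicat_real thin_triangle p * 1) \<partial>lborel) = ennreal ((1::real)^2 / 200 - 0^2 / 200)"
    by (rule thin_triangle_integral[where g="\<lambda>_. 1" and G="\<lambda>t. t^2 / 200"])
       (auto intro!: derivative_eq_intros)
  then have "emeasure lborel thin_triangle = ennreal (1 / 200)"
    by (simp add: ennreal_indicator)
  then show ?thesis by (simp add: measure_def)
qed

lemma thin_triangle_moment: "(LINT p|lborel. indicat_real thin_triangle p * p $ 1) = 1 / 300"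
proof -
  have "(\<integral>\<^sup>+p. ennreal (indicat_real thin_triangle p * p $ 1) \<partial>lborel) = ennreal ((1::real)^3 / 300 - 0^3 / 300)"
    by (rule thin_triangle_integral[where g="\<lambda>t. t" and G="\<lambda>t. t^3 / 300"])
       (auto intro!: derivative_eq_intros simp: power2_eq_square)
  then show ?thesis
    by (subst integral_eq_nn_integral) (auto simp: thin_triangle_def indicator_def)
qed

text \<open>The two long sides contribute half their length. The short side, of length at most \<open>1/100\<close>, is
  absorbed because the perimeter is at least \<open>1\<close>.\<close>

lemma thin_triangle_boundary_integral:
  defines "P \<equiv> measure (hausdorff_measure 1) (frontier thin_triangle)"
  shows "set_integrable (hausdorff_measure 1) (frontier thin_triangle) (\<lambda>p. p $ 1)"
    and "(LINT p:frontier thin_triangle|hausdorff_measure 1. p $ 1) \<le> 51 / 100 * P"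
    and "0 < P"
proof -
  let ?H = "hausdorff_measure 1 :: (real ^ 2) measure"
  define S1 S2 S3 :: "(real ^ 2) set"
    where "S1 = {p. p $ 2 = 0 \<and> 0 \<le> p $ 1 \<and> p $ 1 \<le> 1}"
      and "S2 = {p. p $ 2 = p $ 1 / 100 \<and> 0 \<le> p $ 1 \<and> p $ 1 \<le> 1}"
      and "S3 = {p. p $ 1 = 1 \<and> 0 \<le> p $ 2 \<and> p $ 2 \<le> 1 / 100}"
  have fr: "frontier thin_triangle = S1 \<union> S2 \<union> S3"
  proof (rule set_eqI)
    fix p :: "real ^ 2"
    have "frontier thin_triangle = closure thin_triangle - thin_triangle"
      using thin.open_dom by (simp add: frontier_def interior_open)
    note diff = this[unfolded closure_thin_triangle]
    have "((0 \<le> y \<and> y \<le> x / 100 \<and> x \<le> 1) \<and> \<not> (0 < y \<and> y < x / 100 \<and> x < 1)) \<longleftrightarrow>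
        (y = 0 \<and> 0 \<le> x \<and> x \<le> 1) \<or> (y = x / 100 \<and> 0 \<le> x \<and> x \<le> 1) \<or> (x = 1 \<and> 0 \<le> y \<and> y \<le> 1 / 100)"
      for x y :: real by (smt (verit) divide_less_cancel divide_nonneg_nonneg zero_le_divide_iff)
    from this[of "p $ 2" "p $ 1"] show "p \<in> frontier thin_triangle \<longleftrightarrow> p \<in> S1 \<union> S2 \<union> S3"
      by (subst diff) (simp only: thin_triangle_def S1_def S2_def S3_def
          Diff_iff Un_iff mem_Collect_eq disj_assoc)
  qed
  have [measurable]: "S1 \<in> sets borel" "S2 \<in> sets borel" "S3 \<in> sets borel"
    unfolding S1_def S2_def S3_def by measurable
  have bd: "bounded (frontier thin_triangle)"
    using thin_triangle_bounded bounded_closure by (auto simp: frontier_def intro: bounded_subset)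
  have fin: "emeasure ?H S < \<infinity>" if "S \<subseteq> frontier thin_triangle" for S
  proof -
    have "emeasure ?H S \<le> emeasure ?H (frontier thin_triangle)"
      using that by (intro emeasure_mono) auto
    also have "\<dots> < \<infinity>" using thin.perimeter_finite by (simp add: less_top)
    finally show ?thesis .
  qed
  have intH: "integrable ?H (\<lambda>p. indicat_real S p)"
    if "S \<subseteq> frontier thin_triangle" "S \<in> sets borel" for S
    using fin[OF that(1)] that(2) by (simp add: integrable_indicator_iff)
  have sub: "S1 \<subseteq> frontier thin_triangle" "S2 \<subseteq> frontier thin_triangle" "S3 \<subseteq> frontier thin_triangle"
    using fr by auto
  note I1 = centrally_symmetric_integral[of S1 "plane_point 1 1 0" 1]
  note I2 = centrally_symmetric_integral[of S2 "plane_point 1 1 (1/100)" 1]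
  have sym1: "p \<in> S1 \<Longrightarrow> plane_point 1 1 0 - p \<in> S1" for p by (simp add: S1_def)
  have sym2: "p \<in> S2 \<Longrightarrow> plane_point 1 1 (1/100) - p \<in> S2" for p by (simp add: S2_def diff_divide_distrib)
  have i1: "integrable ?H (\<lambda>p. indicat_real S1 p * p $ 1)"
    and e1: "(LINT p|?H. indicat_real S1 p * p $ 1) = 1 / 2 * measure ?H S1"
    using I1[OF _ bounded_subset[OF bd sub(1)] fin[OF sub(1)] sym1] by simp_all
  have i2: "integrable ?H (\<lambda>p. indicat_real S2 p * p $ 1)"
    and e2: "(LINT p|?H. indicat_real S2 p * p $ 1) = 1 / 2 * measure ?H S2"
    using I2[OF _ bounded_subset[OF bd sub(2)] fin[OF sub(2)] sym2] by simp_all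
  have i3: "integrable ?H (indicat_real S3)" by (rule intH[OF sub(3)]) simp
  have nonneg: "0 \<le> p $ 1" "p $ 1 \<le> 1" if "p \<in> frontier thin_triangle" for p
    using that by (auto simp: fr S1_def S2_def S3_def)
  show int: "set_integrable ?H (frontier thin_triangle) (\<lambda>p. p $ 1)"
    unfolding set_integrable_def
  proof (rule Bochner_Integration.integrable_bound[OF intH[OF order_refl]])
    show "AE p in ?H. norm (indicat_real (frontier thin_triangle) p *\<^sub>R p $ 1)
        \<le> norm (indicat_real (frontier thin_triangle) p)"
      using nonneg by (intro AE_I2) (auto simp: indicator_def)
  qed simp_all
  have "(LINT p:frontier thin_triangle|?H. p $ 1)
      \<le> (LINT p|?H. indicat_real S1 p * p $ 1 + indicat_real S2 p * p $ 1 + indicat_real S3 p)"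
    unfolding set_lebesgue_integral_def
  proof (rule integral_mono)
    show "integrable ?H (\<lambda>p. indicat_real (frontier thin_triangle) p *\<^sub>R p $ 1)"
      using int by (simp add: set_integrable_def)
    show "integrable ?H (\<lambda>p. indicat_real S1 p * p $ 1 + indicat_real S2 p * p $ 1 + indicat_real S3 p)"
      using i1 i2 i3 by simp
    fix p
    show "indicat_real (frontier thin_triangle) p *\<^sub>R p $ 1
        \<le> indicat_real S1 p * p $ 1 + indicat_real S2 p * p $ 1 + indicat_real S3 p"
      unfolding fr by (auto simp: indicator_def S1_def S2_def S3_def)
  qed
  also have "\<dots> = 1 / 2 * (measure ?H S1 + measure ?H S2) + measure ?H S3"
    using i1 i2 i3 unfolding e1[symmetric] e2[symmetric] distrib_left by simp
  also have "\<dots> \<le> 1 / 2 * P + 1 / 100"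
  proof -
    \<comment> \<open>The long sides share only the apex, which is a null set.\<close>
    have S2: "measure ?H S2 = measure ?H (S2 - {0})"
    proof -
      have "emeasure ?H {0} = 0" using hausdorff_outer_singleton[of "0 :: real ^ 2"]
        by (simp add: emeasure_hausdorff_measure)
      then have "{0} \<in> null_sets ?H" by (simp add: null_sets_def)
      then show ?thesis by (simp add: measure_Diff_null_set)
    qed
    have "measure ?H S1 + measure ?H S2 = measure ?H S1 + measure ?H (S2 - {0})" by (simp only: S2)
    also have "\<dots> = measure ?H (S1 \<union> (S2 - {0}))"
    proof (rule measure_Union[symmetric])
      show "S1 \<inter> (S2 - {0}) = {}" by (auto simp: S1_def S2_def vec_eq_iff forall_2)
      show "emeasure ?H S1 \<noteq> \<infinity>" using fin[OF sub(1)] by simp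
      have "S2 - {0} \<subseteq> frontier thin_triangle" using sub(2) by blast
      from fin[OF this] show "emeasure ?H (S2 - {0}) \<noteq> \<infinity>" by simp
    qed simp_all
    also have "\<dots> \<le> P"
      unfolding P_def
      by (rule measure_mono_fmeasurable) (use sub fin in \<open>auto simp: fmeasurable_def\<close>)
    finally have S12: "measure ?H S1 + measure ?H S2 \<le> P" .
    have "measure ?H S3 \<le> 1 / 100"
    proof -
      have "S3 \<subseteq> plane_point 1 1 ` {0..1/100}"
      proof
        fix p assume p: "p \<in> S3"
        then have "p = plane_point 1 1 (p $ 2)" using plane_point_eta[of 1 2 p] by (simp add: S3_def)
        then show "p \<in> plane_point 1 1 ` {0..1/100}" using p by (auto simp: S3_def)
      qed
      then have "hausdorff_outer 1 S3 \<le> ennreal (1 / 100)"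
        by (rule order_trans[OF hausdorff_outer_mono])
           (use hausdorff_outer_segment_le[of 0 "1/100" 1 1] in simp)
      then have "emeasure ?H S3 \<le> ennreal (1 / 100)" by (simp add: emeasure_hausdorff_measure)
      then show ?thesis unfolding measure_def by (rule enn2real_leI[rotated]) simp
    qed
    then show ?thesis using S12 by (intro add_mono mult_left_mono) auto
  qed
  finally have le: "(LINT p:frontier thin_triangle|?H. p $ 1) \<le> 1 / 2 * P + 1 / 100" .
  have P1: "1 \<le> P"
  proof -
    have "emeasure lborel {0..1::real} \<le> emeasure ?H (frontier thin_triangle)"
    proof (rule emeasure_le_hausdorff_1)
      show "{0..1} \<subseteq> (\<lambda>p. p $ 1) ` frontier thin_triangle"
      proof
        fix t :: real assume "t \<in> {0..1}"
        then have "plane_point 1 t 0 \<in> frontier thin_triangle" by (auto simp: fr S1_def)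
        then show "t \<in> (\<lambda>p. p $ 1) ` frontier thin_triangle"
          by (intro image_eqI[of _ _ "plane_point 1 t 0"]) auto
      qed
    qed auto
    then have "ennreal 1 \<le> ennreal P"
      unfolding P_def using thin.perimeter_finite by (simp add: emeasure_eq_ennreal_measure)
    then show ?thesis by (simp add: ennreal_le_iff2)
  qed
  then show "0 < P" by simp
  from le P1 show "(LINT p:frontier thin_triangle|?H. p $ 1) \<le> 51 / 100 * P" by simp
qed

text \<open>The quotient of the means is at least \<open>(2/3) / (51/100) > 5/4\<close>.\<close>

lemma hermite_hadamard_constant_ge:
  assumes "hermite_hadamard_constant c"
  shows "5 / 4 \<le> c"
proof -
  let ?P = "measure (hausdorff_measure 1) (frontier thin_triangle)"
  define I where "I = (LINT p:frontier thin_triangle|hausdorff_measure 1. p $ 1)"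
  have "convex_on (closure thin_triangle) (\<lambda>p. p $ 1)"
    using convex_closure[OF thin.convex_dom] by (simp add: convex_on_def)
  moreover have nonneg: "\<forall>p\<in>frontier thin_triangle. 0 \<le> p $ 1"
    using closure_thin_triangle by (auto simp: frontier_def)
  ultimately have ineq: "1 / measure (hausdorff_measure 2) thin_triangle * (LINT p:thin_triangle|hausdorff_measure 2. p $ 1)
      \<le> c / ?P * I"
    using assms thin_triangle_boundary_integral(1) thin.open_dom thin.ne_dom thin.bounded_dom thin.convex_dom
    unfolding hermite_hadamard_constant_def I_def by blast
  obtain \<kappa> where \<kappa>: "0 < \<kappa>" "(hausdorff_measure 2 :: (real ^ 2) measure) = density lborel (\<lambda>_. ennreal \<kappa>)"
    by (rule hausdorff_measure_2_eq)
  have moment: "(LINT p:thin_triangle|hausdorff_measure 2. p $ 1) = \<kappa> * (1 / 300)"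
    unfolding set_lebesgue_integral_def \<kappa>(2)
    by (subst integral_density) (use \<kappa>(1) thin_triangle_moment in auto)
  have area: "measure (hausdorff_measure 2) thin_triangle = \<kappa> * (1 / 200)"
    using \<kappa>(1) thin_triangle_area by (simp add: \<kappa>(2) measure_def emeasure_density_const enn2real_mult)
  have "1 / (\<kappa> * (1 / 200)) * (\<kappa> * (1 / 300)) \<le> c / ?P * I"
    using ineq unfolding area moment .
  moreover have "1 / (\<kappa> * (1 / 200)) * (\<kappa> * (1 / 300)) = 2 / 3" using \<kappa>(1) by simp
  ultimately have "2 / 3 \<le> c / ?P * I" by (simp only:)
  then have lower: "2 / 3 \<le> c * (I / ?P)" by simp
  have P: "0 < ?P" by (rule thin_triangle_boundary_integral)
  have "0 \<le> I"
    unfolding I_def set_lebesgue_integral_def using nonneg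
    by (intro Bochner_Integration.integral_nonneg) (auto simp: indicator_def)
  then have IP: "0 \<le> I / ?P" "I / ?P \<le> 51 / 100"
    using P thin_triangle_boundary_integral(2) by (auto simp: I_def pos_divide_le_eq)
  have "0 \<le> c"
  proof (rule ccontr)
    assume "\<not> 0 \<le> c"
    then have "c * (I / ?P) \<le> 0" using IP(1) by (intro mult_nonpos_nonneg) auto
    with lower show False by linarith
  qed
  then have "c * (I / ?P) \<le> c * (51 / 100)" using IP(2) by (rule mult_left_mono[rotated])
  with lower show ?thesis by linarith
qed

section \<open>The optimal constant\<close>

theorem mainTheorem7:
  "\<exists>c\<^sub>2 :: real. 9 / 8 < c\<^sub>2 \<and> c\<^sub>2 \<le> 8 \<and>
     hermite_hadamard_constant c\<^sub>2 \<and>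
     (\<forall>c. hermite_hadamard_constant c \<longrightarrow> c\<^sub>2 \<le> c)"
proof -
  define K where "K = Collect hermite_hadamard_constant"
  have ge: "5 / 4 \<le> c" if "c \<in> K" for c
    using hermite_hadamard_constant_ge that by (simp add: K_def)
  then have bdd: "bdd_below K" by (intro bdd_belowI)
  have K8: "8 \<in> K" by (simp add: K_def hermite_hadamard_constant_8)
  have le: "Inf K \<le> c" if "c \<in> K" for c using that bdd by (rule cInf_lower)
  have "5 / 4 \<le> Inf K" using K8 ge by (intro cInf_greatest) auto
  moreover have "hermite_hadamard_constant (Inf K)"
    unfolding hermite_hadamard_constant_def
  proof (intro allI impI)
    fix \<Omega> :: "(real ^ 2) set" and f
    assume hyp: "open \<Omega> \<and> \<Omega> \<noteq> {} \<and> bounded \<Omega> \<and> convex \<Omega> \<and> convex_on (closure \<Omega>) f \<and>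
      (\<forall>x\<in>frontier \<Omega>. 0 \<le> f x) \<and> set_integrable (hausdorff_measure 1) (frontier \<Omega>) f"
    define L where "L = 1 / measure (hausdorff_measure 2) \<Omega> * (LINT x:\<Omega>|hausdorff_measure 2. f x)"
    define R where "R = (LINT x:frontier \<Omega>|hausdorff_measure 1. f x) / measure (hausdorff_measure 1) (frontier \<Omega>)"
    have all: "set_integrable (hausdorff_measure 2) \<Omega> f \<and> L \<le> c * R" if "c \<in> K" for c
      using that hyp unfolding K_def L_def R_def mem_Collect_eq hermite_hadamard_constant_def by simp
    have "0 \<le> R"
      unfolding R_def set_lebesgue_integral_def using hyp
      by (intro divide_nonneg_nonneg Bochner_Integration.integral_nonneg) (auto simp: indicator_def)
    have "L \<le> Inf K * R"
    proof (cases "R = 0")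
      case False
      with \<open>0 \<le> R\<close> have R: "0 < R" by simp
      have "L / R \<le> Inf K"
        using K8 all R by (intro cInf_greatest) (auto simp: pos_divide_le_eq)
      then show ?thesis using R by (simp add: pos_divide_le_eq)
    qed (use all[OF K8] in simp)
    then show "set_integrable (hausdorff_measure 2) \<Omega> f \<and>
        1 / measure (hausdorff_measure 2) \<Omega> * (LINT x:\<Omega>|hausdorff_measure 2. f x)
          \<le> Inf K / measure (hausdorff_measure 1) (frontier \<Omega>) * (LINT x:frontier \<Omega>|hausdorff_measure 1. f x)"
      using all[OF K8] by (simp add: L_def R_def)
  qed
  ultimately show ?thesis
    using le[OF K8] le by (intro exI[of _ "Inf K"]) (auto simp: K_def)
qed

end
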